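(* Let $\gamma>0$ be fixed, and for a distribution $F$ let $G$ be the distribution with tail $\overline G(x)=1$ for $x<0$ and $\overline G(x)=\overline F(x)e^{-\gamma x}$ for $x\ge0$. There exists a distribution $F\in(\mathcal{J}_f\cap\mathcal{K})\setminus(\mathcal{S}\cup\mathcal{D})$ such that $G\in\mathcal{J}$. Moreover, any such $F$ (i.e. any $F\in(\mathcal{J}_f\cap\mathcal{K})\setminus(\mathcal{S}\cup\mathcal{D})$ with $G\in\mathcal{J}$) is in $\mathcal{OS}^*$, and its $G$ satisfies $G\in(\mathcal{J}\cap\mathcal{K}^c)\setminus\big(\bigcup_{\beta>0}\mathcal{S}(\beta)\big)$.
   Context: All distributions are probability distributions $F$ with unbounded support contained in $[0,\infty)$; $\overline F:=1-F$ is the tail and $F^{*2}=F*F$ the two-fold convolution. Asymptotic relations are as $x\to\infty$; $g\sim h$ means $g(x)/h(x)\to1$, and $g=O(h)$ means $\limsup g(x)/h(x)<\infty$. Class $\mathcal{J}$: $F\in\mathcal{J}$ iff, for i.i.d. $X_1,X_2,\dots$ with distribution $F$, $S_n=\sum_{i=1}^n X_i$ and $X_{n,1}=\max_{1\le i\le n}X_i$, one has for all $n\ge2$ (equivalently, for $n=2$) $\lim_{K\to\infty}\liminf_{x\to\infty}\mathbb{P}(X_{n,1}>x-K\mid S_n>x)=1$. $\mathcal{J}_f$ is the class of distributions in $\mathcal{J}$ with finite mean. Class $\mathcal{K}$ (heavy-tailed): $\int_0^\infty e^{\lambda y}F(dy)=\infty$ for all $\lambda>0$. $\mathcal{K}^c$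 (light-tailed) is its complement. Class $\mathcal{S}$ (subexponential): $\overline{F^{*2}}(x)\sim2\overline F(x)$. Class $\mathcal{D}$ (dominatedly varying): $\overline F(tx)=O(\overline F(x))$ for all (equivalently, for some) $t\in(0,1)$. Class $\mathcal{OS}^*$: $F$ has finite mean $\mu>0$ and $\limsup_{x\to\infty}\frac{1}{\overline F(x)}\int_0^x\overline F(x-y)\overline F(y)\,dy<\infty$. For $\beta>0$, $F\in\mathcal{L}(\beta)$ iff $\overline F(x+t)\sim e^{-\beta t}\overline F(x)$ for all $t\ne0$; and $F\in\mathcal{S}(\beta)$ (convolution equivalent) iff $F\in\mathcal{L}(\beta)$, $\int_0^\infty e^{\beta y}F(dy)<\infty$ and $\overline{F^{*2}}(x)\sim2\int_0^\infty e^{\beta y}F(dy)\,\overline F(x)$. *)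

theory Defs
  imports "HOL-Probability.Probability" "HOL-Real_Asymp.Real_Asymp"
begin

text \<open>
  For a law on the real line, the support is contained in \<open>[0,\<infinity>)\<close> iff the negative half-line is
  a null set, and it is then unbounded iff the distribution function never reaches 1.
\<close>

definition nonneg_unbounded_distributions :: "real measure set" where
  "nonneg_unbounded_distributions =
     {F. real_distribution F \<and> measure F {..<0} = 0 \<and> (\<forall>x. cdf F x < 1)}"

definition tail :: "real measure \<Rightarrow> real \<Rightarrow> real" where
  "tail F x = 1 - cdf F x"

text \<open>
  The i.i.d. sample of size \<open>n\<close> is realised as the coordinates of the product space with all
  factors equal to \<open>F\<close>; the conditional probability depends on their joint law only.
\<close>

definition max_given_sum_prob :: "real measure \<Rightarrow> nat \<Rightarrow> real \<Rightarrow> real \<Rightarrow> real" where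
  "max_given_sum_prob F n K x =
     \<P>(\<omega> in (\<Pi>\<^sub>M i\<in>{..<n}. F). Max (\<omega> ` {..<n}) > x - K \<bar> (\<Sum>i<n. \<omega> i) > x)"

definition class_J :: "real measure set" where
  "class_J = {F \<in> nonneg_unbounded_distributions. \<forall>n\<ge>2.
     ((\<lambda>K. Liminf at_top (\<lambda>x. ereal (max_given_sum_prob F n K x))) \<longlongrightarrow> 1) at_top}"

definition class_J_finite_mean :: "real measure set" where
  "class_J_finite_mean = {F \<in> class_J. integrable F (\<lambda>y. y)}"

definition class_K :: "real measure set" where
  "class_K = {F \<in> nonneg_unbounded_distributions.
     \<forall>r>0. (\<integral>\<^sup>+y\<in>{0..}. ennreal (exp (r * y)) \<partial>F) = \<infinity>}"

definition class_K_compl :: "real measure set" where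
  "class_K_compl = nonneg_unbounded_distributions - class_K"

definition class_S :: "real measure set" where
  "class_S = {F \<in> nonneg_unbounded_distributions.
     tail (convolution F F) \<sim>[at_top] (\<lambda>x. 2 * tail F x)}"

definition class_D :: "real measure set" where
  "class_D = {F \<in> nonneg_unbounded_distributions.
     \<forall>t\<in>{0<..<1}. (\<lambda>x. tail F (t * x)) \<in> O[at_top](tail F)}"

definition class_OS_star :: "real measure set" where
  "class_OS_star = {F \<in> nonneg_unbounded_distributions.
     integrable F (\<lambda>y. y) \<and> (\<integral>y. y \<partial>F) > 0 \<and>
     Limsup at_top (\<lambda>x. ereal (1 / tail F x * (LINT y:{0..x}|lborel. tail F (x - y) * tail F y))) < \<infinity>}"

definition class_L_exp :: "real \<Rightarrow> real measure set" where
  "class_L_exp \<beta> = {F \<in> nonneg_unbounded_distributions.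
     \<forall>t. t \<noteq> 0 \<longrightarrow> (\<lambda>x. tail F (x + t)) \<sim>[at_top] (\<lambda>x. exp (- \<beta> * t) * tail F x)}"

definition class_S_exp :: "real \<Rightarrow> real measure set" where
  "class_S_exp \<beta> = {F \<in> class_L_exp \<beta>.
     (\<integral>\<^sup>+y\<in>{0..}. ennreal (exp (\<beta> * y)) \<partial>F) < \<infinity> \<and>
     tail (convolution F F) \<sim>[at_top] (\<lambda>x. 2 * (LINT y:{0..}|F. exp (\<beta> * y)) * tail F x)}"

text \<open>
  The distribution \<open>G\<close> with tail 1 on the negative half-line and \<open>tail F x * exp (- \<gamma> * x)\<close> on
  \<open>[0,\<infinity>)\<close>, as the Lebesgue--Stieltjes measure of its distribution function. By the lemmas below,
  it is the unique distribution with that tail.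
\<close>

definition exp_tempered :: "real \<Rightarrow> real measure \<Rightarrow> real measure" where
  "exp_tempered \<gamma> F =
     interval_measure (\<lambda>x. 1 - (if x < 0 then 1 else tail F x * exp (- \<gamma> * x)))"

context
  fixes \<gamma> :: real and F :: "real measure"
  assumes \<gamma>: "\<gamma> > 0" and F: "F \<in> nonneg_unbounded_distributions"
begin

interpretation F: real_distribution F
  using F by (simp add: nonneg_unbounded_distributions_def)

private definition H where
  "H x = 1 - (if x < 0 then 1 else tail F x * exp (- \<gamma> * x))"

private lemma tail_bounds: "0 < tail F x" "tail F x \<le> 1"
  using F F.cdf_nonneg[of x] by (auto simp: nonneg_unbounded_distributions_def tail_def)

private lemma H_mono:
  assumes "x \<le> y" shows "H x \<le> H y"
proof -
  have *: "tail F y * exp (- \<gamma> * y) \<le> tail F x * exp (- \<gamma> * x)"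
    using assms \<gamma> tail_bounds[of x] tail_bounds[of y] F.cdf_nondecreasing[OF assms]
    by (intro mult_mono) (auto simp: tail_def)
  have **: "tail F y * exp (- \<gamma> * y) \<le> 1" if "0 \<le> y"
    using that \<gamma> tail_bounds[of y] by (intro mult_le_one) auto
  show ?thesis
    using assms * ** by (auto simp: H_def)
qed

private lemma H_right_cont: "continuous (at_right a) H"
proof (cases "a < 0")
  case True
  have "\<forall>\<^sub>F x in at_right a. x < 0"
    using True by (metis eventually_at_right_field)
  then have "\<forall>\<^sub>F x in at_right a. 0 = H x"
    by eventually_elim (simp add: H_def)
  then have "(H \<longlongrightarrow> 0) (at_right a)"
    by (rule Lim_transform_eventually[OF tendsto_const])
  then show ?thesis
    using True by (simp add: continuous_within H_def)
next
  case False
  have "\<forall>\<^sub>F x in at_right a. a < x"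
    by (simp add: eventually_at_right_less)
  then have ev: "\<forall>\<^sub>F x in at_right a. 1 - (1 - cdf F x) * exp (- \<gamma> * x) = H x"
    by eventually_elim (use False in \<open>simp add: H_def tail_def\<close>)
  have "((\<lambda>x. 1 - (1 - cdf F x) * exp (- \<gamma> * x)) \<longlongrightarrow> 1 - (1 - cdf F a) * exp (- \<gamma> * a)) (at_right a)"
    using F.cdf_is_right_cont[of a] by (auto intro!: tendsto_intros simp: continuous_within)
  then have "(H \<longlongrightarrow> 1 - (1 - cdf F a) * exp (- \<gamma> * a)) (at_right a)"
    using ev by (rule Lim_transform_eventually)
  then show ?thesis
    using False by (simp add: continuous_within H_def tail_def)
qed

private lemma H_at_bot: "(H \<longlongrightarrow> 0) at_bot"
proof -
  have "\<forall>\<^sub>F x in at_bot. 0 = H x"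
    by (auto simp: H_def eventually_at_bot_dense)
  then show ?thesis
    by (rule Lim_transform_eventually[OF tendsto_const])
qed

private lemma H_at_top: "(H \<longlongrightarrow> 1) at_top"
proof -
  have ev: "\<forall>\<^sub>F x in at_top. 1 - (1 - cdf F x) * exp (- \<gamma> * x) = H x"
    using eventually_ge_at_top[of 0] by eventually_elim (simp add: H_def tail_def)
  have "((\<lambda>x. exp (- \<gamma> * x)) \<longlongrightarrow> 0) at_top"
    using \<gamma> by real_asymp
  then have "((\<lambda>x. 1 - (1 - cdf F x) * exp (- \<gamma> * x)) \<longlongrightarrow> 1 - (1 - 1) * 0) at_top"
    by (intro tendsto_intros F.cdf_lim_at_top_prob)
  then show ?thesis
    using ev by (auto intro: Lim_transform_eventually)
qed

private lemma exp_tempered_eq: "exp_tempered \<gamma> F = interval_measure H"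
  unfolding exp_tempered_def H_def ..

private lemma cdf_exp_tempered: "cdf (exp_tempered \<gamma> F) = H"
  unfolding exp_tempered_eq by (rule cdf_interval_measure[OF H_mono H_right_cont H_at_bot])

lemma tail_exp_tempered:
  "tail (exp_tempered \<gamma> F) x = (if x < 0 then 1 else tail F x * exp (- \<gamma> * x))"
  by (simp add: tail_def[of "exp_tempered \<gamma> F"] cdf_exp_tempered H_def)

lemma exp_tempered_in_distributions: "exp_tempered \<gamma> F \<in> nonneg_unbounded_distributions"
proof -
  interpret G: real_distribution "exp_tempered \<gamma> F"
    unfolding exp_tempered_eq
    by (rule real_distribution_interval_measure[OF H_mono H_right_cont H_at_bot H_at_top])
  have "\<forall>\<^sub>F x in at_left 0. 0 = H x"
    by (auto simp: H_def eventually_at_left_field intro!: exI[of _ "-1"])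
  then have "(H \<longlongrightarrow> 0) (at_left 0)"
    by (rule Lim_transform_eventually[OF tendsto_const])
  then have "measure (exp_tempered \<gamma> F) {..<0} = 0"
    using G.cdf_at_left[of 0] by (metis cdf_exp_tempered tendsto_unique trivial_limit_at_left_real)
  moreover have "H x < 1" for x
    using tail_bounds[of x] by (simp add: H_def)
  ultimately show ?thesis
    by (simp add: nonneg_unbounded_distributions_def cdf_exp_tempered G.real_distribution_axioms)
qed

lemma exp_tempered_unique:
  assumes G: "real_distribution G"
    and tail_G: "\<And>x. tail G x = (if x < 0 then 1 else tail F x * exp (- \<gamma> * x))"
  shows "G = exp_tempered \<gamma> F"
proof (rule cdf_unique[OF G])
  show "real_distribution (exp_tempered \<gamma> F)"
    using exp_tempered_in_distributions by (simp add: nonneg_unbounded_distributions_def)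
  have "1 - cdf G x = 1 - cdf (exp_tempered \<gamma> F) x" for x
    using tail_G[of x] tail_exp_tempered[of x] by (simp add: tail_def[symmetric])
  then show "cdf G = cdf (exp_tempered \<gamma> F)"
    by (intro ext) (metis diff_left_imp_eq)
qed

end

end

theory Submission
  imports Defs
begin

text \<open>
  Existence: take \<open>F\<close> with tail \<open>exp (- \<lfloor>sqrt x\<rfloor>)\<close>, so that \<open>G\<close> has the tail
  \<open>exp (- \<lfloor>sqrt x\<rfloor> - \<gamma> x)\<close>. If the sum of \<open>n\<close> copies exceeds \<open>x\<close> but the maximum does not
  exceed \<open>x - K\<close>, two of the copies exceed \<open>L = K / n\<close>. Conditioning on the others, membership
  in \<open>\<J>\<close> for every \<open>n\<close> reduces to a bound \<open>P (X\<^sub>1 + X\<^sub>2 > t, X\<^sub>1 > L, X\<^sub>2 > L) \<le> e L * P (X\<^sub>1 + X\<^sub>2 > t)\<close>,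
  uniform in \<open>t\<close>, with \<open>e L \<longlonglongrightarrow> 0\<close>. For both tails it follows from
  \<open>sqrt y + sqrt z \<ge> sqrt (y + z) + sqrt y / 2\<close> for \<open>y \<le> z\<close>; the exponential factor is
  multiplicative and plays no role. The jumps of \<open>F\<close> rule out subexponentiality.

  Properties: membership in \<open>\<J>\<close> makes the tail of the convolution square \<open>O\<close> of the tail. For
  \<open>G\<close> this gives the integral bound of \<open>OS\<^sup>*\<close> for \<open>F\<close>, since \<open>G\<close> gives \<open>(k, k + 1]\<close> mass at
  least \<open>(1 - exp (- \<gamma>)) * exp (- \<gamma> k)\<close> times the tail of \<open>F\<close> at \<open>k\<close>. If \<open>G\<close> were in
  \<open>S(\<beta>)\<close>, the ratio of the tails of \<open>F\<close> at \<open>x + t\<close> and \<open>x\<close> would tend to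
  \<open>exp ((\<gamma> - \<beta>) t)\<close>: impossible for \<open>\<beta> < \<gamma>\<close> by monotonicity and for \<open>\<beta> > \<gamma>\<close> because \<open>F\<close>
  is heavy-tailed, while for \<open>\<beta> = \<gamma>\<close> a long-tailed member of \<open>\<J>\<close> is subexponential.
\<close>

section \<open>Tails and convolution squares\<close>

locale nonneg_unbounded =
  fixes F :: "real measure"
  assumes in_distributions: "F \<in> nonneg_unbounded_distributions"

sublocale nonneg_unbounded \<subseteq> real_distribution F
  using in_distributions by (simp add: nonneg_unbounded_distributions_def)

sublocale nonneg_unbounded \<subseteq> pair: pair_prob_space F F ..

sublocale nonneg_unbounded \<subseteq> prod: product_prob_space "\<lambda>_. F" ..

context nonneg_unbounded
begin

lemma tail_eq_prob: "tail F x = prob {x<..}"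
proof -
  have "{x<..} = space F - {..x}"
    by (auto simp: sets_eq_imp_space_eq[OF events_eq_borel])
  then have "prob {x<..} = 1 - prob {..x}"
    using prob_compl[of "{..x}"] by simp
  then show ?thesis
    by (simp add: tail_def cdf_def)
qed

lemma tail_pos: "0 < tail F x"
  using in_distributions by (simp add: nonneg_unbounded_distributions_def tail_def)

lemma tail_le_1: "tail F x \<le> 1"
  by (simp add: tail_eq_prob)

lemma tail_antimono: "x \<le> y \<Longrightarrow> tail F y \<le> tail F x"
  using cdf_nondecreasing by (simp add: tail_def)

lemma tail_neg: "x < 0 \<Longrightarrow> tail F x = 1"
proof -
  assume "x < 0"
  then have "cdf F x \<le> measure F {..<0}"
    unfolding cdf_def by (intro finite_measure_mono) auto
  then show ?thesis
    using in_distributions cdf_nonneg[of x] by (simp add: nonneg_unbounded_distributions_def tail_def)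
qed

lemma AE_nonneg: "AE x in F. 0 \<le> x"
  using in_distributions
  by (subst AE_iff_measurable[of "{..<0}"])
     (auto simp: nonneg_unbounded_distributions_def emeasure_eq_measure
        sets_eq_imp_space_eq[OF events_eq_borel])

lemma tail_tendsto_0: "(tail F \<longlongrightarrow> 0) at_top"
  using tendsto_diff[OF tendsto_const[of 1] cdf_lim_at_top_prob] by (simp add: tail_def[abs_def])

lemma prob_Ioc: "a \<le> b \<Longrightarrow> prob {a<..b} = tail F a - tail F b"
  using emeasure_Ioc[of a b] cdf_nondecreasing[of a b]
  by (simp add: emeasure_eq_measure tail_def)

lemma pair_rectangle:
  assumes "A \<in> sets borel" "B \<in> sets borel"
  shows "pair.P.prob {p. fst p \<in> A \<and> snd p \<in> B} = prob A * prob B"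
proof -
  have "{p. fst p \<in> A \<and> snd p \<in> B} = A \<times> B"
    by auto
  then show ?thesis
    using assms by (simp add: measure_def emeasure_pair_measure_Times enn2real_mult)
qed

lemma tail_convolution: "tail (convolution F F) x = pair.P.prob {p. fst p + snd p > x}"
proof -
  interpret C: real_distribution "convolution F F"
    unfolding convolution_def by (intro pair.P.real_distribution_distr) measurable
  have "tail (convolution F F) x = measure (convolution F F) {x<..}"
    using C.prob_compl[of "{..x}"] by (simp add: tail_def cdf_def Compl_eq_Diff_UNIV[symmetric])
  also have "\<dots> = pair.P.prob {p. fst p + snd p > x}"
    unfolding convolution_def
    by (subst measure_distr) (auto simp: case_prod_unfold space_pair_measure
       sets_eq_imp_space_eq[OF events_eq_borel] intro!: arg_cong[where f=pair.P.prob])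
  finally show ?thesis .
qed

lemma pair_sets:
  "Measurable.pred (borel \<Otimes>\<^sub>M borel) Q \<Longrightarrow> {p. Q p} \<in> sets (F \<Otimes>\<^sub>M F)"
proof -
  assume "Measurable.pred (borel \<Otimes>\<^sub>M borel) Q"
  then have "{p \<in> space (borel \<Otimes>\<^sub>M borel). Q p} \<in> sets (borel \<Otimes>\<^sub>M borel)"
    by measurable
  then show ?thesis
    by (simp add: space_pair_measure sets_pair_measure_cong[OF events_eq_borel events_eq_borel])
qed

lemma tail_times_le_tail_convolution: "tail F (x - a) * tail F a \<le> tail (convolution F F) x"
proof -
  have "tail F (x - a) * tail F a = pair.P.prob {p. fst p \<in> {x - a<..} \<and> snd p \<in> {a<..}}"
    by (subst pair_rectangle) (auto simp: tail_eq_prob)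
  also have "\<dots> \<le> tail (convolution F F) x"
    unfolding tail_convolution by (intro pair.P.finite_measure_mono pair_sets) auto
  finally show ?thesis .
qed

lemma tail_convolution_pos: "0 < tail (convolution F F) x"
  using tail_times_le_tail_convolution[of x 0] tail_pos[of "x - 0"] tail_pos[of 0]
  by (meson less_le_trans mult_pos_pos)

section \<open>Integrating out two coordinates of a product law\<close>

lemma nn_integral_PiM_insert2:
  assumes "finite J" "i \<notin> J" "j \<notin> J" "i \<noteq> j"
    and f[measurable]: "f \<in> borel_measurable (PiM (insert i (insert j J)) (\<lambda>_. F))"
  shows "(\<integral>\<^sup>+w. f w \<partial>PiM (insert i (insert j J)) (\<lambda>_. F)) =
    (\<integral>\<^sup>+w. \<integral>\<^sup>+p. f (w(j := fst p, i := snd p)) \<partial>(F \<Otimes>\<^sub>M F) \<partial>PiM J (\<lambda>_. F))"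
proof -
  have "(\<integral>\<^sup>+w. f w \<partial>PiM (insert i (insert j J)) (\<lambda>_. F)) =
    (\<integral>\<^sup>+w. \<integral>\<^sup>+z. f (w(i := z)) \<partial>F \<partial>PiM (insert j J) (\<lambda>_. F))"
    using assms by (intro prod.product_nn_integral_insert) auto
  also have "\<dots> = (\<integral>\<^sup>+w. \<integral>\<^sup>+y. \<integral>\<^sup>+z. f (w(j := y, i := z)) \<partial>F \<partial>F \<partial>PiM J (\<lambda>_. F))"
    using assms by (intro prod.product_nn_integral_insert) auto
  also have "\<dots> = (\<integral>\<^sup>+w. \<integral>\<^sup>+p. f (w(j := fst p, i := snd p)) \<partial>(F \<Otimes>\<^sub>M F) \<partial>PiM J (\<lambda>_. F))"
  proof (rule nn_integral_cong)
    fix w assume [measurable]: "w \<in> space (PiM J (\<lambda>_. F))"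
    have "(\<lambda>p. w(j := fst p, i := snd p)) \<in> measurable (F \<Otimes>\<^sub>M F) (PiM (insert i (insert j J)) (\<lambda>_. F))"
      by (intro measurable_fun_upd[where J="insert j J"] measurable_fun_upd[where J=J]) auto
    then have "(\<lambda>p. f (w(j := fst p, i := snd p))) \<in> borel_measurable (F \<Otimes>\<^sub>M F)"
      by measurable
    from nn_integral_fst[OF this]
    show "(\<integral>\<^sup>+y. \<integral>\<^sup>+z. f (w(j := y, i := z)) \<partial>F \<partial>F) =
      (\<integral>\<^sup>+p. f (w(j := fst p, i := snd p)) \<partial>(F \<Otimes>\<^sub>M F))"
      by simp
  qed
  finally show ?thesis .
qed

text \<open>The two coordinates are kept together, so that the inner measure is their joint law and
  a two-variable estimate can be applied for each fixed \<open>w\<close>.\<close>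

lemma emeasure_PiM_insert2:
  assumes "finite J" "i \<notin> J" "j \<notin> J" "i \<noteq> j"
    and [measurable]: "Measurable.pred (PiM (insert i (insert j J)) (\<lambda>_. F)) Q"
  shows "emeasure (PiM (insert i (insert j J)) (\<lambda>_. F))
      {w \<in> space (PiM (insert i (insert j J)) (\<lambda>_. F)). Q w} =
    (\<integral>\<^sup>+w. emeasure (F \<Otimes>\<^sub>M F) {p. Q (w(j := fst p, i := snd p))} \<partial>PiM J (\<lambda>_. F))"
proof -
  let ?M = "PiM (insert i (insert j J)) (\<lambda>_. F)"
  have "emeasure ?M {w \<in> space ?M. Q w} = (\<integral>\<^sup>+w. indicator {w \<in> space ?M. Q w} w \<partial>?M)"
    by simp
  also have "\<dots> = (\<integral>\<^sup>+w. \<integral>\<^sup>+p. indicator {w \<in> space ?M. Q w} (w(j := fst p, i := snd p))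
      \<partial>(F \<Otimes>\<^sub>M F) \<partial>PiM J (\<lambda>_. F))"
    using assms by (intro nn_integral_PiM_insert2) auto
  also have "\<dots> = (\<integral>\<^sup>+w. emeasure (F \<Otimes>\<^sub>M F) {p. Q (w(j := fst p, i := snd p))} \<partial>PiM J (\<lambda>_. F))"
  proof (rule nn_integral_cong)
    fix w assume w[measurable]: "w \<in> space (PiM J (\<lambda>_. F))"
    have [measurable]: "(\<lambda>p. w(j := fst p, i := snd p)) \<in> measurable (F \<Otimes>\<^sub>M F) ?M"
      by (intro measurable_fun_upd[where J="insert j J"] measurable_fun_upd[where J=J]) auto
    have sp: "space (F \<Otimes>\<^sub>M F) = UNIV"
      by (simp add: space_pair_measure sets_eq_imp_space_eq[OF events_eq_borel])
    have "{p \<in> space (F \<Otimes>\<^sub>M F). Q (w(j := fst p, i := snd p))} \<in> sets (F \<Otimes>\<^sub>M F)"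
      by measurable
    then have [measurable]: "{p. Q (w(j := fst p, i := snd p))} \<in> sets (F \<Otimes>\<^sub>M F)"
      by (simp add: sp)
    have "(\<integral>\<^sup>+p. indicator {w \<in> space ?M. Q w} (w(j := fst p, i := snd p)) \<partial>(F \<Otimes>\<^sub>M F)) =
      (\<integral>\<^sup>+p. indicator {p. Q (w(j := fst p, i := snd p))} p \<partial>(F \<Otimes>\<^sub>M F))"
      using w by (intro nn_integral_cong)
        (auto simp: indicator_def space_PiM PiE_def extensional_def sets_eq_imp_space_eq[OF events_eq_borel])
    then show "(\<integral>\<^sup>+p. indicator {w \<in> space ?M. Q w} (w(j := fst p, i := snd p)) \<partial>(F \<Otimes>\<^sub>M F)) =
      emeasure (F \<Otimes>\<^sub>M F) {p. Q (w(j := fst p, i := snd p))}"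
      by (simp only:) (simp only: nn_integral_indicator \<open>{p. Q (w(j := fst p, i := snd p))} \<in> sets (F \<Otimes>\<^sub>M F)\<close>)
  qed
  finally show ?thesis .
qed

lemma max_given_sum_prob_2:
  "max_given_sum_prob F 2 K x =
    pair.P.prob {p. x - K < max (fst p) (snd p) \<and> x < fst p + snd p} / pair.P.prob {p. x < fst p + snd p}"
proof -
  have two: "{..<2} = {0, 1::nat}"
    by auto
  let ?M = "PiM {0, 1::nat} (\<lambda>_. F)"
  interpret M: prob_space ?M
    by (intro prob_space_PiM prob_space_axioms)
  \<comment> \<open>Coordinate 1 comes first because \<open>emeasure_PiM_insert2\<close> puts
    \<open>fst p\<close> into \<open>j\<close> and \<open>snd p\<close> into \<open>i\<close>, here
    1 and 0. The symmetry of sum and maximum undoes the swap at the end.\<close>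
  have eq: "M.prob {\<omega> \<in> space ?M. Q (\<omega> 1) (\<omega> 0)} = pair.P.prob {p. Q (fst p) (snd p)}"
    if [measurable]: "Measurable.pred (borel \<Otimes>\<^sub>M borel) (\<lambda>p. Q (fst p) (snd p))" for Q
  proof -
    have m: "(\<lambda>\<omega>. (\<omega> 1, \<omega> 0)) \<in> measurable ?M (borel \<Otimes>\<^sub>M borel)"
      by measurable
    have "Measurable.pred ?M (\<lambda>\<omega>. Q (\<omega> 1) (\<omega> 0))"
      using measurable_compose[OF m that] by simp
    then have "emeasure ?M {\<omega> \<in> space ?M. Q (\<omega> 1) (\<omega> 0)} = emeasure (F \<Otimes>\<^sub>M F) {p. Q (fst p) (snd p)}"
      by (subst emeasure_PiM_insert2) (simp_all add: prod.nn_integral_empty del: nn_integral_const)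
    then show ?thesis
      by (simp add: measure_def)
  qed
  show ?thesis
    unfolding max_given_sum_prob_def cond_prob_def two
    using eq[of "\<lambda>y z. x - K < max y z \<and> x < y + z"] eq[of "\<lambda>y z. x < y + z"]
    by (simp add: add.commute max.commute)
qed

section \<open>A criterion for membership in \<open>\<J>\<close>\<close>

lemma borel_measurable_component:
  fixes I :: "'i set"
  shows "k \<in> I \<Longrightarrow> (\<lambda>w. w k) \<in> borel_measurable (PiM I (\<lambda>_. F))"
  by measurable

lemma prob_second_largest_le:
  fixes I :: "'i set"
  assumes I: "finite I" "i \<in> I" "j \<in> I" "i \<noteq> j" and "0 \<le> e"
    and le: "\<And>t. pair.P.prob {p. L < snd p \<and> snd p \<le> fst p \<and> t < fst p + snd p} \<le>
      e * pair.P.prob {p. t < fst p + snd p}"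
  shows "measure (PiM I (\<lambda>_. F))
      {w \<in> space (PiM I (\<lambda>_. F)). L < w i \<and> w i \<le> w j \<and> x < (\<Sum>k\<in>I. w k)} \<le>
    e * measure (PiM I (\<lambda>_. F)) {w \<in> space (PiM I (\<lambda>_. F)). x < (\<Sum>k\<in>I. w k)}"
proof -
  define J where "J = I - {i, j}"
  have I_eq: "I = insert i (insert j J)" and J: "finite J" "i \<notin> J" "j \<notin> J"
    using I by (auto simp: J_def)
  let ?M = "PiM I (\<lambda>_. F)"
  interpret M: prob_space ?M
    by (intro prob_space_PiM prob_space_axioms)
  interpret C: real_distribution "convolution F F"
    unfolding convolution_def by (intro pair.P.real_distribution_distr) measurable
  have sum_eq: "(\<Sum>k\<in>I. (w(j := y, i := z)) k) = z + y + (\<Sum>k\<in>J. w k)" for w :: "'i \<Rightarrow> real" and y z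
    using J I unfolding I_eq by (auto intro!: sum.cong)
  have m: "emeasure (F \<Otimes>\<^sub>M F) {p. t < fst p + snd p} = ennreal (tail (convolution F F) t)" for t
    by (simp add: tail_convolution pair.P.emeasure_eq_measure)
  \<comment> \<open>Monotone functions are Borel; this lets \<open>e\<close> be taken out of the
    integral below.\<close>
  have [measurable]: "tail (convolution F F) \<in> borel_measurable borel"
    using borel_measurable_mono[of "cdf (convolution F F)"] C.cdf_nondecreasing
    by (simp add: mono_def tail_def[abs_def])
  have J_meas: "(\<lambda>w. \<Sum>k\<in>J. w k) \<in> borel_measurable (PiM J (\<lambda>_. F))"
    by (intro borel_measurable_sum borel_measurable_component)
  have sum_meas: "(\<lambda>w. \<Sum>k\<in>I. w k) \<in> borel_measurable ?M"
    by (intro borel_measurable_sum borel_measurable_component)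
  have pred: "Measurable.pred ?M (\<lambda>w. L < w i \<and> w i \<le> w j \<and> x < (\<Sum>k\<in>I. w k))"
    "Measurable.pred ?M (\<lambda>w. x < (\<Sum>k\<in>I. w k))"
    unfolding pred_def
    by (intro sets.sets_Collect_conj borel_measurable_less borel_measurable_le
      sum_meas borel_measurable_const borel_measurable_component I)+
  have "emeasure ?M {w \<in> space ?M. L < w i \<and> w i \<le> w j \<and> x < (\<Sum>k\<in>I. w k)} =
    (\<integral>\<^sup>+w. emeasure (F \<Otimes>\<^sub>M F) {p. L < snd p \<and> snd p \<le> fst p \<and> x - (\<Sum>k\<in>J. w k) < fst p + snd p}
      \<partial>PiM J (\<lambda>_. F))"
    unfolding I_eq
    by (subst emeasure_PiM_insert2)
       (use J I pred in \<open>auto simp: I_eq[symmetric] sum_eq[unfolded fun_upd_def] fun_upd_def algebra_simps intro!: nn_integral_cong arg_cong[where f="emeasure _"]\<close>)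
  also have "\<dots> \<le> (\<integral>\<^sup>+w. ennreal e * emeasure (F \<Otimes>\<^sub>M F) {p. x - (\<Sum>k\<in>J. w k) < fst p + snd p}
      \<partial>PiM J (\<lambda>_. F))"
    using le \<open>0 \<le> e\<close>
    by (intro nn_integral_mono) (auto simp: pair.P.emeasure_eq_measure ennreal_mult[symmetric])
  also have "\<dots> = ennreal e * (\<integral>\<^sup>+w. emeasure (F \<Otimes>\<^sub>M F) {p. x - (\<Sum>k\<in>J. w k) < fst p + snd p}
      \<partial>PiM J (\<lambda>_. F))"
    unfolding m using J_meas by (intro nn_integral_cmult) measurable
  also have "(\<integral>\<^sup>+w. emeasure (F \<Otimes>\<^sub>M F) {p. x - (\<Sum>k\<in>J. w k) < fst p + snd p} \<partial>PiM J (\<lambda>_. F)) =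
     emeasure ?M {w \<in> space ?M. x < (\<Sum>k\<in>I. w k)}"
    unfolding I_eq
    by (subst emeasure_PiM_insert2)
       (use J I pred in \<open>auto simp: I_eq[symmetric] sum_eq[unfolded fun_upd_def] fun_upd_def algebra_simps intro!: nn_integral_cong arg_cong[where f="emeasure _"]\<close>)
  finally show ?thesis
    using \<open>0 \<le> e\<close> by (simp add: M.emeasure_eq_measure ennreal_mult[symmetric])
qed

lemma prob_sum_gt_pos:
  fixes I :: "'i set"
  assumes "finite I" "I \<noteq> {}"
  shows "0 < measure (PiM I (\<lambda>_. F)) {w \<in> space (PiM I (\<lambda>_. F)). x < (\<Sum>k\<in>I. w k)}"
proof -
  let ?M = "PiM I (\<lambda>_. F)"
  interpret M: finite_product_prob_space "\<lambda>_. F" I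
    by standard (use assms in auto)
  \<comment> \<open>The maximum with 0 makes all coordinates positive, so a single one above
    \<open>x\<close> pushes the sum above \<open>x\<close>.\<close>
  have "0 < (\<Prod>i\<in>I. measure F {max x 0<..})"
    using tail_pos tail_eq_prob by (intro prod_pos) auto
  also have "\<dots> = M.prob (\<Pi>\<^sub>E i\<in>I. {max x 0<..})"
    by (subst M.prob_times) auto
  also have "\<dots> \<le> M.prob {w \<in> space ?M. x < (\<Sum>k\<in>I. w k)}"
  proof (rule M.finite_measure_mono)
    show "(\<Pi>\<^sub>E i\<in>I. {max x 0<..}) \<subseteq> {w \<in> space ?M. x < (\<Sum>k\<in>I. w k)}"
    proof (safe, goal_cases)
      case (1 w)
      then show ?case
        by (auto simp: space_PiM PiE_def)
    next
      case (2 w)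
      obtain k where k: "k \<in> I"
        using assms by auto
      have "x < w k"
        using 2 k by (auto simp: PiE_def Pi_def)
      also have "w k \<le> (\<Sum>k\<in>I. w k)"
        using 2 k assms by (intro member_le_sum) (auto simp: PiE_def Pi_def less_imp_le)
      finally show ?case .
    qed
  qed measurable
  finally show ?thesis .
qed

text \<open>Failure means a sum above \<open>x\<close> with maximum \<open>w j\<close> at most
  \<open>x - K\<close>. The other \<open>n - 1\<close> coordinates then add up to more than
  \<open>K\<close>, so one of them exceeds \<open>L\<close>, which is at most \<open>K / n\<close>.
  The union bound over at most \<open>n ^ 2\<close> ordered pairs \<open>(i, j)\<close> gives the
  factor.\<close>

lemma max_given_sum_prob_ge:
  assumes "n \<ge> 2" "0 \<le> e" "0 \<le> K" and L: "L \<le> K / real n"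
    and le: "\<And>t. pair.P.prob {p. L < snd p \<and> snd p \<le> fst p \<and> t < fst p + snd p} \<le>
      e * pair.P.prob {p. t < fst p + snd p}"
  shows "1 - real n ^ 2 * e \<le> max_given_sum_prob F n K x"
proof -
  let ?I = "{..<n}"
  let ?M = "PiM ?I (\<lambda>_. F)"
  interpret M: prob_space ?M
    by (intro prob_space_PiM prob_space_axioms)
  define S where "S = {w \<in> space ?M. x < (\<Sum>k<n. w k)}"
  define A where "A = {w \<in> space ?M. x - K < Max (w ` ?I) \<and> x < (\<Sum>k<n. w k)}"
  define E where "E = (\<lambda>(i, j). {w \<in> space ?M. L < w i \<and> w i \<le> w j \<and> x < (\<Sum>k<n. w k)})"
  define P where "P = {(i, j). i < n \<and> j < n \<and> i \<noteq> j}"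
  have P_sub: "P \<subseteq> ?I \<times> ?I"
    by (auto simp: P_def)
  have P_fin: "finite P"
    by (rule finite_subset[OF P_sub]) auto
  have P_card: "real (card P) \<le> real n ^ 2"
    using card_mono[OF _ P_sub] by (simp add: power2_eq_square flip: of_nat_mult)
  have S[measurable]: "S \<in> sets ?M"
    unfolding S_def by measurable
  have ne: "?I \<noteq> {}"
    using \<open>n \<ge> 2\<close> by (simp add: lessThan_empty_iff)
  have "(\<lambda>w. Max (w ` ?I)) \<in> borel_measurable ?M"
    using ne borel_measurable_Max[of ?I "\<lambda>i w. w i" ?M] by (auto simp: image_def)
  then have A[measurable]: "A \<in> sets ?M"
    unfolding A_def by measurable
  have E: "E p \<in> sets ?M" if "p \<in> P" for p
    unfolding E_def case_prod_unfold
    by (intro sets.sets_Collect_conj borel_measurable_less borel_measurable_le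
      borel_measurable_sum borel_measurable_const borel_measurable_component)
      (use that in \<open>auto simp: P_def\<close>)
  have sub: "S - A \<subseteq> (\<Union>p\<in>P. E p)"
  proof
    fix w assume w: "w \<in> S - A"
    have "Max (w ` ?I) \<in> w ` ?I"
      using ne by (intro Max_in) auto
    then obtain j where j: "j < n" "w j = Max (w ` ?I)"
      by auto
    have w_le: "w i \<le> w j" if "i < n" for i
      unfolding j(2) using that by (intro Max_ge) auto
    have split: "(\<Sum>k<n. w k) = w j + (\<Sum>k\<in>?I - {j}. w k)"
      using j by (subst sum.remove[of _ j]) auto
    have "\<exists>i\<in>?I - {j}. L < w i"
    proof (rule ccontr)
      assume "\<not> ?thesis"
      then have "(\<Sum>k\<in>?I - {j}. w k) \<le> (\<Sum>k\<in>?I - {j}. K / n)"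
        using L by (intro sum_mono) force
      also have "\<dots> = (real n - 1) * (K / n)"
        using j by (simp add: of_nat_diff)
      finally have sum_le: "(\<Sum>k\<in>?I - {j}. w k) \<le> (real n - 1) * (K / n)" .
      have "x < w j + (\<Sum>k\<in>?I - {j}. w k)" "w j \<le> x - K"
        using w j split by (auto simp: S_def A_def)
      with sum_le have "K < (real n - 1) * (K / n)"
        by linarith
      also have "\<dots> = K - K / n"
        using assms by (simp add: field_simps)
      finally have "K / n < 0"
        by simp
      then show False
        using \<open>0 \<le> K\<close> by (simp add: divide_less_0_iff)
    qed
    then obtain i where "i < n" "i \<noteq> j" "L < w i"
      by auto
    then have "(i, j) \<in> P" "w \<in> E (i, j)"
      using w j(1) w_le by (auto simp: E_def P_def S_def)
    then show "w \<in> (\<Union>p\<in>P. E p)"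
      by blast
  qed
  have "M.prob S - M.prob A = M.prob (S - A)"
    by (subst M.finite_measure_Diff) (auto simp: A_def S_def)
  also have "\<dots> \<le> M.prob (\<Union>p\<in>P. E p)"
    using E P_fin by (intro M.finite_measure_mono sub) auto
  also have "\<dots> \<le> (\<Sum>p\<in>P. M.prob (E p))"
    using E P_fin by (intro M.finite_measure_subadditive_finite) auto
  also have "\<dots> \<le> (\<Sum>p\<in>P. e * M.prob S)"
  proof (rule sum_mono)
    fix p assume "p \<in> P"
    then show "M.prob (E p) \<le> e * M.prob S"
      using prob_second_largest_le[of ?I "fst p" "snd p" e L x] \<open>0 \<le> e\<close> le
      by (auto simp: P_def E_def S_def)
  qed
  also have "\<dots> = real (card P) * (e * M.prob S)"
    by simp
  also have "\<dots> \<le> real n ^ 2 * (e * M.prob S)"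
    using P_card \<open>0 \<le> e\<close> by (intro mult_right_mono) auto
  finally have "(1 - real n ^ 2 * e) * M.prob S \<le> M.prob A"
    by (simp add: algebra_simps)
  moreover have "0 < M.prob S"
    unfolding S_def by (rule prob_sum_gt_pos) (use ne in auto)
  ultimately have "1 - real n ^ 2 * e \<le> M.prob A / M.prob S"
    by (simp add: pos_le_divide_eq)
  then show ?thesis
    by (simp add: max_given_sum_prob_def cond_prob_def A_def S_def)
qed

lemma max_given_sum_prob_le_1: "max_given_sum_prob F n K x \<le> 1"
proof -
  interpret M: prob_space "PiM {..<n} (\<lambda>_. F)"
    by (intro prob_space_PiM prob_space_axioms)
  show ?thesis
    unfolding max_given_sum_prob_def cond_prob_def
    by (intro divide_le_eq_1[THEN iffD2]) (auto simp: zero_less_measure_iff intro!: M.finite_measure_mono)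
qed

lemma class_J_criterion:
  fixes e :: "nat \<Rightarrow> real"
  assumes e: "e \<longlonglongrightarrow> 0"
    and le: "\<And>L t. pair.P.prob {p. real L < snd p \<and> snd p \<le> fst p \<and> t < fst p + snd p} \<le>
      e L * pair.P.prob {p. t < fst p + snd p}"
  shows "F \<in> class_J"
  unfolding class_J_def
proof (intro CollectI conjI allI impI in_distributions)
  fix n :: nat assume n: "n \<ge> 2"
  \<comment> \<open>At \<open>t = 0\<close> a nonnegative number is bounded by \<open>e L\<close>
    times a positive one.\<close>
  have e_nonneg: "0 \<le> e L" for L
    using order_trans[OF measure_nonneg le[of L 0]] tail_convolution_pos[of 0]
    by (simp add: tail_convolution zero_le_mult_iff)
  \<comment> \<open>The levels of the criterion are natural numbers, so \<open>K / n\<close> is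
    rounded down; \<open>N K\<close> still tends to infinity with \<open>K\<close>.\<close>
  define N where "N K = nat \<lfloor>K / n\<rfloor>" for K
  have "filterlim N at_top at_top"
    unfolding N_def using n by real_asymp
  then have "((\<lambda>K. e (N K)) \<longlongrightarrow> 0) at_top"
    by (rule filterlim_compose[OF e])
  then have lim: "((\<lambda>K. ereal (1 - real n ^ 2 * e (N K))) \<longlongrightarrow> 1) at_top"
    by (auto intro!: tendsto_eq_intros simp: one_ereal_def)
  show "((\<lambda>K. Liminf at_top (\<lambda>x. ereal (max_given_sum_prob F n K x))) \<longlongrightarrow> 1) at_top"
  proof (rule tendsto_sandwich[OF _ _ lim tendsto_const])
    show "\<forall>\<^sub>F K in at_top. ereal (1 - real n ^ 2 * e (N K)) \<le>
        Liminf at_top (\<lambda>x. ereal (max_given_sum_prob F n K x))"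
      using eventually_gt_at_top[of 0]
    proof eventually_elim
      case (elim K)
      have "real (N K) \<le> K / real n"
        using elim by (simp add: N_def)
      then have "1 - real n ^ 2 * e (N K) \<le> max_given_sum_prob F n K x" for x
        using n elim by (intro max_given_sum_prob_ge[where L="real (N K)"] le e_nonneg) auto
      then show ?case
        by (intro Liminf_bounded always_eventually) auto
    qed
    show "\<forall>\<^sub>F K in at_top. Liminf at_top (\<lambda>x. ereal (max_given_sum_prob F n K x)) \<le> 1"
      by (intro always_eventually allI Liminf_le) (auto simp: max_given_sum_prob_le_1)
  qed
qed

section \<open>Consequences of membership in \<open>\<J>\<close>\<close>

text \<open>This is the definition for \<open>n = 2\<close>: a share of at least
  \<open>1 - e\<close> of the event that the sum exceeds \<open>x\<close> has a coordinate above
  \<open>x - K\<close>. The union bound over the two coordinates gives the factor 2.\<close>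

lemma class_J_tail_convolution_le:
  assumes "F \<in> class_J" "0 < e"
  obtains K where "K > 0"
    "\<forall>\<^sub>F x in at_top. (1 - e) * tail (convolution F F) x \<le> 2 * tail F (x - K)"
proof -
  have "((\<lambda>K. Liminf at_top (\<lambda>x. ereal (max_given_sum_prob F 2 K x))) \<longlongrightarrow> 1) at_top"
    using assms by (simp add: class_J_def)
  then have "\<forall>\<^sub>F K in at_top. ereal (1 - e) < Liminf at_top (\<lambda>x. ereal (max_given_sum_prob F 2 K x))"
    using assms by (intro order_tendstoD(1)) (auto simp: one_ereal_def)
  then have "\<forall>\<^sub>F K in at_top. ereal (1 - e) < Liminf at_top (\<lambda>x. ereal (max_given_sum_prob F 2 K x)) \<and> 0 < K"
    using eventually_gt_at_top by (rule eventually_conj)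
  then obtain K where K: "0 < K"
    "ereal (1 - e) < Liminf at_top (\<lambda>x. ereal (max_given_sum_prob F 2 K x))"
    using eventually_happens trivial_limit_at_top_linorder by blast
  have "\<forall>\<^sub>F x in at_top. (1 - e) * tail (convolution F F) x \<le> 2 * tail F (x - K)"
    using less_LiminfD[OF K(2)]
  proof eventually_elim
    case (elim x)
    let ?A = "{p. x - K < max (fst p) (snd p) \<and> x < fst p + snd p}"
    have "1 - e < pair.P.prob ?A / tail (convolution F F) x"
      using elim by (simp add: max_given_sum_prob_2 tail_convolution)
    then have "(1 - e) * tail (convolution F F) x < pair.P.prob ?A"
      using tail_convolution_pos[of x] by (simp add: pos_less_divide_eq)
    also have "\<dots> \<le> pair.P.prob ({p. fst p \<in> {x - K<..} \<and> snd p \<in> UNIV} \<union> {p. fst p \<in> UNIV \<and> snd p \<in> {x - K<..}})"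
      by (intro pair.P.finite_measure_mono sets.Un pair_sets) (auto simp: max_def split: if_splits)
    also have "\<dots> \<le> pair.P.prob {p. fst p \<in> {x - K<..} \<and> snd p \<in> UNIV} +
        pair.P.prob {p. fst p \<in> UNIV \<and> snd p \<in> {x - K<..}}"
      by (intro measure_Un_le pair_sets) measurable
    also have "\<dots> = 2 * tail F (x - K)"
      using pair_rectangle[of "{x - K<..}" UNIV] pair_rectangle[of UNIV "{x - K<..}"] prob_space
      by (simp add: tail_eq_prob)
    finally show ?case
      by simp
  qed
  with K show ?thesis
    using that by blast
qed

text \<open>The convolution square at \<open>x + K\<close> is bounded above by a multiple of the
  tail at \<open>x\<close>, and below by \<open>tail F (x - a) * tail F (a + K)\<close>, whose
  second factor does not depend on \<open>x\<close>.\<close>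

lemma class_J_tail_shift_bound:
  assumes "F \<in> class_J"
  obtains C where "C > 0" "\<forall>\<^sub>F x in at_top. tail F (x - a) \<le> C * tail F x"
proof -
  obtain K where K: "K > 0" "\<forall>\<^sub>F x in at_top. (1 - 1/2) * tail (convolution F F) x \<le> 2 * tail F (x - K)"
    using class_J_tail_convolution_le[OF assms, of "1/2"] by auto
  \<comment> \<open>The 4 is \<open>2 / (1 - 1/2)\<close>.\<close>
  let ?C = "4 / tail F (a + K)"
  have "\<forall>\<^sub>F x in at_top. (1 - 1/2) * tail (convolution F F) (x + K) \<le> 2 * tail F (x + K - K)"
    using K(2) by (rule eventually_compose_filterlim) real_asymp
  then have "\<forall>\<^sub>F x in at_top. tail F (x - a) \<le> ?C * tail F x"
  proof eventually_elim
    case (elim x)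
    then show ?case
      using tail_times_le_tail_convolution[of "x + K" "a + K"] tail_pos[of "a + K"]
      by (simp add: field_simps)
  qed
  then show ?thesis
    using that[of ?C] tail_pos[of "a + K"] by simp
qed

lemma class_J_tail_convolution_bound:
  assumes "F \<in> class_J"
  obtains C where "C > 0" "\<forall>\<^sub>F x in at_top. tail (convolution F F) x \<le> C * tail F x"
proof -
  obtain K where K: "K > 0" "\<forall>\<^sub>F x in at_top. (1 - 1/2) * tail (convolution F F) x \<le> 2 * tail F (x - K)"
    using class_J_tail_convolution_le[OF assms, of "1/2"] by auto
  obtain C where C: "C > 0" "\<forall>\<^sub>F x in at_top. tail F (x - K) \<le> C * tail F x"
    using class_J_tail_shift_bound[OF assms] .
  have "\<forall>\<^sub>F x in at_top. tail (convolution F F) x \<le> 4 * C * tail F x"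
    using K(2) C(2) by eventually_elim simp
  then show ?thesis
    using that[of "4 * C"] C by simp
qed

section \<open>Moment bounds from sums of tails, and light tails\<close>

lemma nn_integral_le_tail_sum:
  fixes f a :: "_ \<Rightarrow> real"
  assumes [measurable]: "f \<in> borel_measurable borel"
    and f_le: "\<And>n y. real n < y \<Longrightarrow> y \<le> real n + 1 \<Longrightarrow> f y \<le> a n"
    and a: "\<And>n. 0 \<le> a n" and summable: "summable (\<lambda>n. a n * tail F (real n))"
  shows "(\<integral>\<^sup>+y\<in>{0..}. ennreal (f y) \<partial>F) < \<infinity>"
proof -
  \<comment> \<open>For \<open>real n < y \<le> real n + 1\<close> the summand of index
    \<open>n\<close> alone dominates \<open>f y\<close>. The term \<open>f 0\<close> covers a
    possible atom at 0, which lies in none of these cells.\<close>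
  have pointwise: "ennreal (f y) * indicator {0..} y \<le>
    ennreal (f 0) + (\<Sum>n. ennreal (a n) * indicator {real n<..} y)" for y
  proof (cases "y > 0")
    case True
    define n where "n = nat (\<lceil>y\<rceil> - 1)"
    have n: "real n < y" "y \<le> real n + 1"
      using True unfolding n_def by linarith+
    define g where "g n = ennreal (a n) * indicator {real n<..} y" for n
    have "ennreal (f y) * indicator {0..} y \<le> g n"
      using n True f_le[of n y] by (simp add: ennreal_leI g_def)
    also have "\<dots> \<le> suminf g"
      using sum_le_suminf[of g "{n}"] by simp
    finally show ?thesis
      unfolding g_def by (rule order_trans) simp
  next
    case False
    then show ?thesis
      by (cases "y = 0") auto
  qed
  have "(\<integral>\<^sup>+y\<in>{0..}. ennreal (f y) \<partial>F) \<le>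
      (\<integral>\<^sup>+y. ennreal (f 0) + (\<Sum>n. ennreal (a n) * indicator {real n<..} y) \<partial>F)"
    by (intro nn_integral_mono pointwise)
  also have "\<dots> = ennreal (f 0) + (\<integral>\<^sup>+y. (\<Sum>n. ennreal (a n) * indicator {real n<..} y) \<partial>F)"
    by (subst nn_integral_add) (auto simp: emeasure_space_1[simplified])
  also have "(\<integral>\<^sup>+y. (\<Sum>n. ennreal (a n) * indicator {real n<..} y) \<partial>F) =
      (\<Sum>n. ennreal (a n * tail F (real n)))"
    by (subst nn_integral_suminf)
      (auto simp: nn_integral_cmult_indicator emeasure_eq_measure tail_eq_prob ennreal_mult a)
  also have "ennreal (f 0) + (\<Sum>n. ennreal (a n * tail F (real n))) < \<infinity>"
  proof -
    have "(\<Sum>n. ennreal (a n * tail F (real n))) \<noteq> top"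
      by (intro ennreal_suminf_neq_top summable mult_nonneg_nonneg a less_imp_le tail_pos)
    then show ?thesis
      by (simp add: less_top[symmetric])
  qed
  finally show ?thesis .
qed

lemma exp_tail_bound_imp_light_tailed:
  assumes c: "c > 0" and le: "\<And>x. x \<ge> 0 \<Longrightarrow> tail F x \<le> C * exp (- c * x)"
  shows "F \<notin> class_K"
proof -
  have "(\<integral>\<^sup>+y\<in>{0..}. ennreal (exp (c / 2 * y)) \<partial>F) < \<infinity>"
  \<comment> \<open>Half the rate in the moment leaves a factor \<open>exp (- c / 2)\<close> per
    unit step, hence a geometric series.\<close>
  proof (rule nn_integral_le_tail_sum[where a="\<lambda>n. exp (c / 2 * (real n + 1))"])
    show "summable (\<lambda>n. exp (c / 2 * (real n + 1)) * tail F (real n))"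
    proof (rule summable_comparison_test'[where N=0])
      show "summable (\<lambda>n. C * exp (c / 2) * exp (- c / 2) ^ n)"
        using c by (intro summable_mult summable_geometric) auto
      fix n :: nat
      have "exp (c / 2 * (real n + 1)) * tail F (real n) \<le>
          exp (c / 2 * (real n + 1)) * (C * exp (- c * real n))"
        using le[of "real n"] by (intro mult_left_mono) auto
      also have "\<dots> = C * exp (c / 2) * exp (- c / 2) ^ n"
      proof -
        have "c / 2 * (real n + 1) + - c * real n = c / 2 + real n * (- c / 2)"
          by (simp add: field_simps)
        then have "exp (c / 2 * (real n + 1)) * exp (- c * real n) = exp (c / 2) * exp (- c / 2) ^ n"
          unfolding exp_add[symmetric] exp_of_nat_mult[symmetric] by (simp only:)
        then show ?thesis
          by (simp only: mult.left_commute[of _ C] mult.assoc)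
      qed
      finally show "norm (exp (c / 2 * (real n + 1)) * tail F (real n)) \<le>
          C * exp (c / 2) * exp (- c / 2) ^ n"
        using tail_pos[of "real n"] by (simp add: abs_mult)
    qed
  qed (use c in auto)
  then show ?thesis
    using c by (auto simp: class_K_def intro!: exI[of _ "c / 2"])
qed

text \<open>Iterating the contraction from some \<open>X\<close> gives exponential decay along
  \<open>X + real n\<close>, and monotonicity of the tail fills the gaps.\<close>

lemma exp_decay_imp_light_tailed:
  assumes c: "c > 0" and ev: "\<forall>\<^sub>F x in at_top. tail F (x + 1) \<le> exp (- c) * tail F x"
  shows "F \<notin> class_K"
proof -
  obtain X where X: "\<And>x. x \<ge> X \<Longrightarrow> tail F (x + 1) \<le> exp (- c) * tail F x"
    using ev by (auto simp: eventually_at_top_linorder)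
  have iterate: "tail F (X + real n) \<le> exp (- c * real n)" for n
  proof (induction n)
    case 0
    then show ?case
      by (simp add: tail_le_1)
  next
    case (Suc n)
    have "tail F (X + real (Suc n)) \<le> exp (- c) * tail F (X + real n)"
      using X[of "X + real n"] by (simp add: algebra_simps)
    also have "\<dots> \<le> exp (- c) * exp (- c * real n)"
      using Suc by (intro mult_left_mono) auto
    also have "\<dots> = exp (- c * real (Suc n))"
      by (simp add: exp_add[symmetric] algebra_simps)
    finally show ?case .
  qed
  show ?thesis
  \<comment> \<open>The 1 in \<open>X + 1\<close> pays for rounding \<open>x - X\<close> down to an
    integer. Below \<open>X\<close> the bound is at least 1.\<close>
  proof (rule exp_tail_bound_imp_light_tailed[OF c, where C="exp (c * (X + 1))"])
    fix x :: real
    show "tail F x \<le> exp (c * (X + 1)) * exp (- c * x)"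
    proof (cases "x \<ge> X")
      case True
      define n where "n = nat \<lfloor>x - X\<rfloor>"
      have n: "X + real n \<le> x" "x - X - 1 \<le> real n"
        using True unfolding n_def by linarith+
      have "tail F x \<le> exp (- c * real n)"
        using tail_antimono[OF n(1)] iterate[of n] by linarith
      also have "\<dots> \<le> exp (- c * (x - X - 1))"
        using n c by simp
      finally show ?thesis
        by (simp add: exp_add[symmetric] algebra_simps)
    next
      case False
      then have "0 \<le> c * (X + 1 - x)"
        using c by auto
      then have "1 \<le> exp (c * (X + 1)) * exp (- c * x)"
        by (simp add: exp_add[symmetric] algebra_simps)
      then show ?thesis
        using tail_le_1[of x] by linarith
    qed
  qed
qed

section \<open>Lower bounds for the convolution square, and subexponentiality\<close>

lemma prob_atLeast_0: "prob {0..} = 1"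
  using AE_nonneg by (subst prob_eq_1) auto

lemma tail_le_tail_convolution: "tail F x \<le> tail (convolution F F) x"
proof -
  have "tail F x = pair.P.prob {p. fst p \<in> {x<..} \<and> snd p \<in> {0..}}"
    by (subst pair_rectangle) (auto simp: tail_eq_prob prob_atLeast_0)
  also have "\<dots> \<le> tail (convolution F F) x"
    unfolding tail_convolution by (intro pair.P.finite_measure_mono pair_sets) auto
  finally show ?thesis .
qed

text \<open>Up to null sets, the event that some coordinate exceeds \<open>x\<close> is split into
  the disjoint rectangles \<open>?A\<close> and \<open>?B\<close>; nonnegativity of the other
  coordinate places both in the event that the sum exceeds \<open>x\<close>.\<close>

lemma tail_convolution_ge:
  assumes "x \<ge> 0"
  shows "2 * tail F x - tail F x ^ 2 \<le> tail (convolution F F) x"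
proof -
  let ?A = "{p. fst p \<in> {x<..} \<and> snd p \<in> {0..}}" and ?B = "{p. fst p \<in> {0..x} \<and> snd p \<in> {x<..}}"
  have "{0..} = {0..x} \<union> {x<..}"
    using assms by auto
  then have "prob {0..x} = 1 - tail F x"
    using finite_measure_Union[of "{0..x}" "{x<..}"] prob_atLeast_0
    by (simp add: tail_eq_prob ivl_disj_int)
  then have "pair.P.prob ?B = (1 - tail F x) * tail F x"
    by (subst pair_rectangle) (auto simp flip: tail_eq_prob)
  moreover have "pair.P.prob ?A = tail F x"
    by (subst pair_rectangle) (auto simp: prob_atLeast_0 simp flip: tail_eq_prob)
  ultimately have "2 * tail F x - tail F x ^ 2 = pair.P.prob ?A + pair.P.prob ?B"
    by (simp add: power2_eq_square algebra_simps)
  also have "\<dots> = pair.P.prob (?A \<union> ?B)"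
    by (intro measure_Union[symmetric] pair_sets) auto
  also have "\<dots> \<le> tail (convolution F F) x"
    unfolding tail_convolution by (intro pair.P.finite_measure_mono pair_sets) auto
  finally show ?thesis .
qed

text \<open>The lower bound is \<open>tail_convolution_ge\<close> with a vanishing tail. For the
  upper bound, \<open>class_J\<close> compares the convolution square with
  \<open>2 * tail F (x - K)\<close>, and long-tailedness removes the shift.\<close>

lemma class_J_long_tailed_imp_class_S:
  assumes J: "F \<in> class_J" and long: "\<And>t. t \<noteq> 0 \<Longrightarrow> ((\<lambda>x. tail F (x + t) / tail F x) \<longlongrightarrow> 1) at_top"
  shows "F \<in> class_S"
  unfolding class_S_def
proof (intro CollectI conjI in_distributions asymp_equivI' order_tendstoI)
  fix a :: real assume "a < 1"
  then have "\<forall>\<^sub>F x in at_top. tail F x < 2 - 2 * a"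
    using tail_tendsto_0 by (intro order_tendstoD(2)) auto
  then show "\<forall>\<^sub>F x in at_top. a < tail (convolution F F) x / (2 * tail F x)"
    using eventually_ge_at_top[of 0]
  proof eventually_elim
    case (elim x)
    have "2 * a * tail F x < (2 - tail F x) * tail F x"
      using elim tail_pos[of x] by (intro mult_strict_right_mono) auto
    also have "\<dots> \<le> tail (convolution F F) x"
      using tail_convolution_ge[OF elim(2)] by (simp add: power2_eq_square algebra_simps)
    finally show ?case
      using tail_pos[of x] by (simp add: field_simps)
  qed
next
  fix a :: real assume a: "1 < a"
  \<comment> \<open>Chosen so that \<open>(1 - e) * a\<close> is the midpoint of 1 and
    \<open>a\<close>, leaving room for the ratio of \<open>tail F (x - K)\<close> to
    \<open>tail F x\<close>.\<close>
  define e where "e = (a - 1) / (2 * a)"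
  have e: "0 < e" "(1 - e) * a = (a + 1) / 2"
    using a by (auto simp: e_def field_simps)
  obtain K where K: "K > 0" "\<forall>\<^sub>F x in at_top. (1 - e) * tail (convolution F F) x \<le> 2 * tail F (x - K)"
    using class_J_tail_convolution_le[OF J e(1)] .
  have "1 < (a + 1) / 2"
    using a by simp
  then have "\<forall>\<^sub>F x in at_top. tail F (x + - K) / tail F x < (a + 1) / 2"
    using long[of "- K"] K(1) by (intro order_tendstoD(2)) auto
  then show "\<forall>\<^sub>F x in at_top. tail (convolution F F) x / (2 * tail F x) < a"
    using K(2)
  proof eventually_elim
    case (elim x)
    have "(1 - e) * tail (convolution F F) x < 2 * ((a + 1) / 2 * tail F x)"
      using elim tail_pos[of x] by (simp add: field_simps)
    also have "\<dots> = (1 - e) * (2 * a * tail F x)"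
      by (simp add: e(2)[symmetric])
    finally have "(1 - e) * tail (convolution F F) x < (1 - e) * (2 * a * tail F x)" .
    moreover have "0 < 1 - e"
      using e(2) a zero_less_mult_pos2[of "1 - e" a] by simp
    ultimately have "tail (convolution F F) x < 2 * a * tail F x"
      by (simp only: mult_less_cancel_left_pos)
    then show ?case
      using tail_pos[of x] by (simp add: field_simps)
  qed
qed

section \<open>Exponential tempering\<close>

lemma nonneg_unbounded_exp_tempered:
  assumes "\<gamma> > 0"
  shows "nonneg_unbounded (exp_tempered \<gamma> F)"
  by (simp add: nonneg_unbounded_def exp_tempered_in_distributions[OF assms in_distributions])

lemma exp_tempered_light_tailed:
  assumes "\<gamma> > 0"
  shows "exp_tempered \<gamma> F \<in> class_K_compl"
proof -
  interpret G: nonneg_unbounded "exp_tempered \<gamma> F"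
    by (rule nonneg_unbounded_exp_tempered[OF assms])
  have "tail F x * exp (- \<gamma> * x) \<le> 1 * exp (- \<gamma> * x)" for x
    using tail_le_1[of x] by (intro mult_right_mono) auto
  then have "exp_tempered \<gamma> F \<notin> class_K"
    using assms by (intro G.exp_tail_bound_imp_light_tailed[where c=\<gamma> and C=1])
      (auto simp: tail_exp_tempered[OF assms in_distributions])
  then show ?thesis
    by (simp add: class_K_compl_def G.in_distributions)
qed

lemma exp_tempered_not_convolution_equivalent:
  assumes "\<gamma> > 0" "F \<in> class_J" "F \<in> class_K" "F \<notin> class_S"
  shows "exp_tempered \<gamma> F \<notin> class_S_exp \<beta>"
proof
  assume G: "exp_tempered \<gamma> F \<in> class_S_exp \<beta>"
  \<comment> \<open>Tempering multiplies this ratio by \<open>exp (- \<gamma> * t)\<close> once both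
    arguments are nonnegative; dividing it out of \<open>exp (- \<beta> * t)\<close> leaves the
    stated limit.\<close>
  have lim: "((\<lambda>x. tail F (x + t) / tail F x) \<longlongrightarrow> exp ((\<gamma> - \<beta>) * t)) at_top" if "t \<noteq> 0" for t
  proof -
    have *: "(\<lambda>x. tail (exp_tempered \<gamma> F) (x + t)) \<sim>[at_top]
        (\<lambda>x. exp (- \<beta> * t) * tail (exp_tempered \<gamma> F) x)"
      using G that by (simp add: class_S_exp_def class_L_exp_def)
    have ev: "\<forall>\<^sub>F x in at_top. x \<ge> 0 \<and> x + t \<ge> 0"
      using eventually_ge_at_top[of 0] eventually_ge_at_top[of "- t"] by eventually_elim auto
    have "((\<lambda>x. tail (exp_tempered \<gamma> F) (x + t) / (exp (- \<beta> * t) * tail (exp_tempered \<gamma> F) x)) \<longlongrightarrow> 1) at_top"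
      using ev tail_pos by (intro asymp_equivD_strong[OF *])
        (auto elim!: eventually_mono simp: tail_exp_tempered[OF assms(1) in_distributions] less_imp_neq[THEN not_sym])
    then have "((\<lambda>x. exp ((\<gamma> - \<beta>) * t) *
        (tail (exp_tempered \<gamma> F) (x + t) / (exp (- \<beta> * t) * tail (exp_tempered \<gamma> F) x))) \<longlongrightarrow>
        exp ((\<gamma> - \<beta>) * t) * 1) at_top"
      by (intro tendsto_intros)
    moreover have "\<forall>\<^sub>F x in at_top. exp ((\<gamma> - \<beta>) * t) *
        (tail (exp_tempered \<gamma> F) (x + t) / (exp (- \<beta> * t) * tail (exp_tempered \<gamma> F) x)) =
        tail F (x + t) / tail F x"
      using ev
    proof eventually_elim
      case (elim x)
      have "exp ((\<gamma> - \<beta>) * t) * exp (- \<gamma> * (x + t)) = exp (- \<beta> * t) * exp (- \<gamma> * x)"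
        by (simp add: exp_add[symmetric] algebra_simps)
      then show ?case
        using elim tail_pos[of x]
        by (simp add: tail_exp_tempered[OF assms(1) in_distributions] divide_simps)
    qed
    ultimately show ?thesis
      by (auto elim: Lim_transform_eventually)
  qed
  \<comment> \<open>A decreasing tail has ratios at most 1 for \<open>t = 1\<close>, so
    \<open>\<gamma> \<le> \<beta>\<close>.\<close>
  have "exp ((\<gamma> - \<beta>) * 1) \<le> 1"
    using tail_antimono[of _ "_ + 1"] tail_pos
    by (intro tendsto_upperbound[OF lim[of 1]] always_eventually) (auto simp: pos_divide_le_eq)
  then consider "\<gamma> = \<beta>" | "\<gamma> < \<beta>"
    by force
  then show False
  proof cases
    case 1
    then show False
      using class_J_long_tailed_imp_class_S lim assms by auto
  next
    case 2
    \<comment> \<open>Half of the limiting rate leaves the slack that makes the contraction hold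
      eventually.\<close>
    then have "\<gamma> - \<beta> < - ((\<beta> - \<gamma>) / 2)"
      by (simp add: field_simps)
    then have "\<forall>\<^sub>F x in at_top. tail F (x + 1) / tail F x < exp (- ((\<beta> - \<gamma>) / 2))"
      by (intro order_tendstoD(2)[OF lim[of 1]]) auto
    then have "\<forall>\<^sub>F x in at_top. tail F (x + 1) \<le> exp (- ((\<beta> - \<gamma>) / 2)) * tail F x"
      by eventually_elim (use tail_pos in \<open>simp add: pos_divide_less_eq less_imp_le\<close>)
    then show False
      using exp_decay_imp_light_tailed[of "(\<beta> - \<gamma>) / 2"] 2 assms by simp
  qed
qed

text \<open>The rectangles \<open>R k\<close> are disjoint and force the sum above \<open>x\<close>.
  In each of them the exponential factors combine to the same
  \<open>exp (- \<gamma> * (x + 1))\<close>, so only tails of \<open>F\<close> depend on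
  \<open>k\<close>.\<close>

lemma sum_tail_products_le:
  assumes "\<gamma> > 0" "real N \<le> x + 1"
  shows "(1 - exp (- \<gamma>)) * exp (- \<gamma> * (x + 1)) * (\<Sum>k\<le>N. tail F (x - real k) * tail F (real k)) \<le>
    tail (convolution (exp_tempered \<gamma> F) (exp_tempered \<gamma> F)) x"
proof -
  interpret G: nonneg_unbounded "exp_tempered \<gamma> F"
    by (rule nonneg_unbounded_exp_tempered[OF assms(1)])
  let ?G = "tail (exp_tempered \<gamma> F)"
  note tail_G = tail_exp_tempered[OF assms(1) in_distributions]
  define R where "R k = {p. fst p \<in> {real k<..real k + 1} \<and> snd p \<in> {x - real k<..}}" for k
  have "(1 - exp (- \<gamma>)) * exp (- \<gamma> * (x + 1)) * (\<Sum>k\<le>N. tail F (x - real k) * tail F (real k)) =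
    (\<Sum>k\<le>N. ((1 - exp (- \<gamma>)) * exp (- \<gamma> * real k) * tail F (real k)) *
      (exp (- \<gamma> * (x - real k + 1)) * tail F (x - real k)))"
    unfolding sum_distrib_left
  proof (intro sum.cong refl)
    fix k
    have *: "exp (- \<gamma> * (x + 1)) = exp (- \<gamma> * real k) * exp (- \<gamma> * (x - real k + 1))"
      by (simp add: exp_add[symmetric] algebra_simps)
    show "(1 - exp (- \<gamma>)) * exp (- \<gamma> * (x + 1)) * (tail F (x - real k) * tail F (real k)) =
      ((1 - exp (- \<gamma>)) * exp (- \<gamma> * real k) * tail F (real k)) *
      (exp (- \<gamma> * (x - real k + 1)) * tail F (x - real k))"
      unfolding * by (simp only: mult_ac)
  qed
  also have "\<dots> \<le> (\<Sum>k\<le>N. G.pair.P.prob (R k))"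
  proof (intro sum_mono)
    fix k assume "k \<in> {..N}"
    \<comment> \<open>As \<open>k\<close> may exceed \<open>x\<close> by up to 1,
      \<open>x - real k\<close> can be negative, where the tail of \<open>G\<close> is 1. The added
      1 in the exponent keeps the exponential factor at most 1 there.\<close>
    then have k: "x - real k + 1 \<ge> 0"
      using assms by auto
    have "tail F (real k + 1) * exp (- \<gamma> * (real k + 1)) \<le> tail F (real k) * exp (- \<gamma> * (real k + 1))"
      using tail_antimono[of "real k" "real k + 1"] by (intro mult_right_mono) auto
    moreover have "exp (- \<gamma> * (real k + 1)) = exp (- \<gamma>) * exp (- \<gamma> * real k)"
      by (simp add: exp_add[symmetric] algebra_simps)
    ultimately have "(1 - exp (- \<gamma>)) * exp (- \<gamma> * real k) * tail F (real k) \<le>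
        tail F (real k) * exp (- \<gamma> * real k) - tail F (real k + 1) * exp (- \<gamma> * (real k + 1))"
      by (simp only: left_diff_distrib right_diff_distrib mult_1_left mult_ac)
    then have "(1 - exp (- \<gamma>)) * exp (- \<gamma> * real k) * tail F (real k) \<le> ?G (real k) - ?G (real k + 1)"
      by (simp add: tail_G)
    moreover have "exp (- \<gamma> * (x - real k + 1)) * tail F (x - real k) \<le> ?G (x - real k)"
    proof (cases "x - real k < 0")
      case True
      have "exp (- \<gamma> * (x - real k + 1)) * tail F (x - real k) \<le> 1 * 1"
        using k assms tail_le_1 tail_pos by (intro mult_mono) (auto simp: less_imp_le)
      then show ?thesis
        using True by (simp add: tail_G)
    next
      case False
      have "tail F (x - real k) * exp (- \<gamma> * (x - real k + 1)) \<le> tail F (x - real k) * exp (- \<gamma> * (x - real k))"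
        using assms tail_pos[of "x - real k"] by (intro mult_left_mono) (auto simp: less_imp_le)
      then show ?thesis
        using False by (simp add: tail_G mult.commute)
    qed
    ultimately have "((1 - exp (- \<gamma>)) * exp (- \<gamma> * real k) * tail F (real k)) *
        (exp (- \<gamma> * (x - real k + 1)) * tail F (x - real k)) \<le>
      (?G (real k) - ?G (real k + 1)) * ?G (x - real k)"
      using tail_pos[of "x - real k"] G.tail_antimono[of "real k" "real k + 1"]
      by (intro mult_mono) auto
    also have "\<dots> = G.pair.P.prob (R k)"
      unfolding R_def by (subst G.pair_rectangle) (auto simp: G.prob_Ioc G.tail_eq_prob)
    finally show "((1 - exp (- \<gamma>)) * exp (- \<gamma> * real k) * tail F (real k)) *
        (exp (- \<gamma> * (x - real k + 1)) * tail F (x - real k)) \<le> G.pair.P.prob (R k)" .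
  qed
  also have "\<dots> = G.pair.P.prob (\<Union>k\<le>N. R k)"
  proof (rule G.pair.P.finite_measure_finite_Union[symmetric])
    show "disjoint_family_on R {..N}"
    proof (unfold disjoint_family_on_def, safe)
      fix i j :: nat and y z :: real
      assume "i \<noteq> j" "(y, z) \<in> R i" "(y, z) \<in> R j"
      then have "real i < real j + 1" "real j < real i + 1"
        by (auto simp: R_def)
      with \<open>i \<noteq> j\<close> show "(y, z) \<in> {}"
        by linarith
    qed
    show "R ` {..N} \<subseteq> G.pair.P.events"
      unfolding R_def by (intro image_subsetI G.pair_sets) measurable
  qed auto
  also have "\<dots> \<le> tail (convolution (exp_tempered \<gamma> F) (exp_tempered \<gamma> F)) x"
    unfolding G.tail_convolution by (intro G.pair.P.finite_measure_mono G.pair_sets) (auto simp: R_def)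
  finally show ?thesis .
qed

text \<open>On the unit cell from \<open>k\<close> to \<open>k + 1\<close> both tails are bounded by
  their values at the least arguments, \<open>k\<close> and \<open>x - 1 - k\<close>.\<close>

lemma integral_tail_products_le:
  assumes "x \<ge> 0"
  shows "(LINT y:{0..x}|lborel. tail F (x - y) * tail F y) \<le>
    (\<Sum>k\<le>nat \<lfloor>x\<rfloor>. tail F (x - 1 - real k) * tail F (real k))"
proof -
  let ?a = "\<lambda>k. tail F (x - 1 - real k) * tail F (real k)"
  let ?g = "\<lambda>y. \<Sum>k\<le>nat \<lfloor>x\<rfloor>. ?a k * indicator {real k..real k + 1} y"
  have a: "0 \<le> ?a k" for k
    using tail_pos by (simp add: less_imp_le)
  have "(LINT y:{0..x}|lborel. tail F (x - y) * tail F y) \<le> (LINT y|lborel. ?g y)"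
    unfolding set_lebesgue_integral_def
  \<comment> \<open>This rule asks only for integrability and nonnegativity of the majorant
    \<open>?g\<close>.\<close>
  proof (rule integral_mono')
    show "integrable lborel ?g"
      by (intro Bochner_Integration.integrable_sum integrable_mult_right) simp
    fix y :: real
    show g_nonneg: "0 \<le> ?g y"
      using a by (intro sum_nonneg) auto
    show "indicator {0..x} y *\<^sub>R (tail F (x - y) * tail F y) \<le> ?g y"
    proof (cases "y \<in> {0..x}")
      case True
      define k where "k = nat \<lfloor>y\<rfloor>"
      have k: "real k \<le> y" "y \<le> real k + 1" "k \<le> nat \<lfloor>x\<rfloor>"
        using True unfolding k_def by (auto simp: nat_mono floor_mono)
      have "tail F (x - y) * tail F y \<le> ?a k"
        using k tail_pos by (intro mult_mono tail_antimono) (auto simp: less_imp_le)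
      also have "\<dots> = ?a k * indicator {real k..real k + 1} y"
        using k by simp
      also have "\<dots> \<le> ?g y"
        using a k by (intro member_le_sum) auto
      finally show ?thesis
        using True by simp
    next
      case False
      then show ?thesis
        using g_nonneg by simp
    qed
  qed
  also have "\<dots> = (\<Sum>k\<le>nat \<lfloor>x\<rfloor>. ?a k)"
    by (subst Bochner_Integration.integral_sum) auto
  finally show ?thesis .
qed

lemma mean_pos:
  assumes "integrable F (\<lambda>y. y)"
  shows "0 < (\<integral>y. y \<partial>F)"
proof -
  have "tail F 1 = (\<integral>y. indicator {1<..} y \<partial>F)"
    by (simp add: tail_eq_prob)
  also have "\<dots> \<le> (\<integral>y. y \<partial>F)"
  proof (rule integral_mono_AE[OF _ assms])
    show "AE y in F. indicator {1<..} y \<le> y"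
      using AE_nonneg by eventually_elim (auto simp: indicator_def)
  qed (simp add: emeasure_eq_measure)
  finally show ?thesis
    using tail_pos[of 1] by linarith
qed

text \<open>The sum dominating the integral comes from the convolution square of \<open>G\<close> at
  \<open>x - 1\<close>. Membership in \<open>class_J\<close> bounds that by a multiple of the tail
  of \<open>G\<close> at \<open>x - 1\<close>, hence at \<open>x\<close>, and
  \<open>exp (- \<gamma> * x)\<close> cancels.\<close>

lemma class_OS_star_if_exp_tempered_class_J:
  assumes \<gamma>: "\<gamma> > 0" and J: "exp_tempered \<gamma> F \<in> class_J" and mean: "integrable F (\<lambda>y. y)"
  shows "F \<in> class_OS_star"
proof -
  interpret G: nonneg_unbounded "exp_tempered \<gamma> F"
    by (rule nonneg_unbounded_exp_tempered[OF \<gamma>])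
  let ?G = "tail (exp_tempered \<gamma> F)"
  let ?GG = "tail (convolution (exp_tempered \<gamma> F) (exp_tempered \<gamma> F))"
  let ?c = "1 - exp (- \<gamma>)"
  note tail_G = tail_exp_tempered[OF \<gamma> in_distributions]
  have c: "0 < ?c"
    using \<gamma> by simp
  obtain C where C: "C > 0" "\<forall>\<^sub>F x in at_top. ?GG x \<le> C * ?G x"
    using G.class_J_tail_convolution_bound[OF J] .
  obtain D where D: "D > 0" "\<forall>\<^sub>F x in at_top. ?G (x - 1) \<le> D * ?G x"
    using G.class_J_tail_shift_bound[OF J] .
  have "\<forall>\<^sub>F x in at_top. ?GG (x - 1) \<le> C * ?G (x - 1)"
    using C(2) by (rule eventually_compose_filterlim) real_asymp
  then have "\<forall>\<^sub>F x in at_top. ereal (1 / tail F x * (LINT y:{0..x}|lborel. tail F (x - y) * tail F y)) \<le>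
      ereal (C * D / ?c)"
    using D(2) eventually_ge_at_top[of 0]
  proof eventually_elim
    case (elim x)
    let ?S = "\<Sum>k\<le>nat \<lfloor>x\<rfloor>. tail F (x - 1 - real k) * tail F (real k)"
    have "real (nat \<lfloor>x\<rfloor>) \<le> x - 1 + 1"
      using elim by simp
    then have "?c * exp (- \<gamma> * (x - 1 + 1)) * ?S \<le> ?GG (x - 1)"
      by (rule sum_tail_products_le[OF \<gamma>])
    also have "\<dots> \<le> C * (D * ?G x)"
      using elim C(1) by (meson less_imp_le mult_left_mono order_trans)
    finally have "(?c * ?S) * exp (- \<gamma> * x) \<le> (C * D * tail F x) * exp (- \<gamma> * x)"
      using elim by (simp add: tail_G mult_ac)
    then have "?S * ?c \<le> C * D * tail F x"
      by (simp only: mult_le_cancel_right_pos exp_gt_zero mult.commute[of ?c])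
    then have "?S \<le> C * D / ?c * tail F x"
      using c by (simp add: pos_le_divide_eq)
    then have "(LINT y:{0..x}|lborel. tail F (x - y) * tail F y) \<le> C * D / ?c * tail F x"
      using integral_tail_products_le[OF elim(3)] by linarith
    then show ?case
      using tail_pos[of x] by (simp add: field_simps)
  qed
  then have "Limsup at_top (\<lambda>x. ereal (1 / tail F x * (LINT y:{0..x}|lborel. tail F (x - y) * tail F y))) \<le>
      ereal (C * D / ?c)"
    by (rule Limsup_bounded)
  also have "\<dots> < \<infinity>"
    by simp
  finally show ?thesis
    using in_distributions mean mean_pos[OF mean] by (simp add: class_OS_star_def)
qed

end

section \<open>The square-root tail\<close>

text \<open>Squaring \<open>sqrt z + sqrt y / 2\<close> produces the cross term
  \<open>sqrt z * sqrt y\<close>, which is at least \<open>y\<close>.\<close>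

lemma sqrt_sum_le:
  fixes y z :: real
  assumes "0 \<le> y" "y \<le> z"
  shows "sqrt (y + z) + sqrt y / 2 \<le> sqrt y + sqrt z"
proof -
  have "y + z \<le> (sqrt z + sqrt y / 2) ^ 2"
  proof -
    have "y = sqrt y * sqrt y"
      using assms by simp
    also have "\<dots> \<le> sqrt z * sqrt y"
      using assms by (intro mult_right_mono) auto
    finally show ?thesis
      using assms by (simp add: power2_eq_square algebra_simps)
  qed
  then have "sqrt (y + z) \<le> sqrt z + sqrt y / 2"
    using assms by (intro real_le_lsqrt) auto
  then show ?thesis
    by simp
qed

text \<open>One locale serves both laws: \<open>\<gamma> = 0\<close> is the law \<open>F\<close>
  itself, \<open>\<gamma> > 0\<close> its tempered version.\<close>

locale sqrt_tail = nonneg_unbounded +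
  fixes \<gamma> :: real
  assumes \<gamma>_nonneg: "0 \<le> \<gamma>"
    and tail_sqrt: "x \<ge> 0 \<Longrightarrow> tail F x = exp (- real_of_int \<lfloor>sqrt x\<rfloor> - \<gamma> * x)"
begin

lemma tail_sqrt_bounds:
  assumes "x \<ge> 0"
  shows "exp (- sqrt x - \<gamma> * x) \<le> tail F x" "tail F x \<le> exp (1 - sqrt x - \<gamma> * x)"
proof -
  have "real_of_int \<lfloor>sqrt x\<rfloor> \<le> sqrt x" "sqrt x - 1 \<le> real_of_int \<lfloor>sqrt x\<rfloor>"
    by linarith+
  then show "exp (- sqrt x - \<gamma> * x) \<le> tail F x" "tail F x \<le> exp (1 - sqrt x - \<gamma> * x)"
    unfolding tail_sqrt[OF assms] exp_le_cancel_iff by linarith+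
qed

text \<open>The decay in \<open>m\<close> is the gain of \<open>sqrt_sum_le\<close>. In
  \<open>3 + \<gamma>\<close>, 2 pays for the two floors, while 1 and \<open>\<gamma>\<close> pay
  for \<open>t\<close> exceeding \<open>real m + z\<close> by up to 1, in the root and in the linear
  term.\<close>

lemma tail_product_le:
  fixes m :: nat and t :: real
  defines "z \<equiv> max (real m) (t - real m - 1)"
  shows "tail F (real m) * tail F z \<le> exp (3 + \<gamma>) * exp (- sqrt (real m) / 2) * tail F t"
proof -
  have z: "real m \<le> z" "t \<le> real m + z + 1"
    by (auto simp: z_def)
  have "tail F (real m) * tail F z \<le> exp (1 - sqrt (real m) - \<gamma> * real m) * exp (1 - sqrt z - \<gamma> * z)"
    using z tail_pos by (intro mult_mono tail_sqrt_bounds) (auto simp: less_imp_le)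
  also have "\<dots> = exp (2 - (sqrt (real m) + sqrt z) - \<gamma> * (real m + z))"
    by (simp add: exp_add[symmetric] algebra_simps)
  also have "\<dots> \<le> exp (2 - (sqrt (real m + z) + sqrt (real m) / 2) - \<gamma> * (real m + z))"
    using sqrt_sum_le[of "real m" z] z by auto
  also have "\<dots> \<le> exp (3 + \<gamma>) * exp (- sqrt (real m) / 2) * tail F t"
  proof (cases "t < 0")
    case True
    have "0 \<le> sqrt (real m + z)" "0 \<le> \<gamma> * (real m + z)"
      using z \<gamma>_nonneg by auto
    then have "exp (2 - (sqrt (real m + z) + sqrt (real m) / 2) - \<gamma> * (real m + z)) \<le>
        exp (3 + \<gamma> + - sqrt (real m) / 2)"
      using \<gamma>_nonneg unfolding exp_le_cancel_iff by linarith
    then show ?thesis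
      using True by (simp only: exp_add tail_neg mult_1_right)
  next
    case False
    have "sqrt t \<le> sqrt (real m + z + 1)"
      using z by simp
    also have "\<dots> \<le> sqrt (real m + z) + sqrt 1"
      using z by (intro sqrt_add_le_add_sqrt) auto
    finally have "sqrt t \<le> sqrt (real m + z) + 1"
      by simp
    moreover have "\<gamma> * t \<le> \<gamma> * (real m + z + 1)"
      using z \<gamma>_nonneg by (intro mult_left_mono) auto
    ultimately have "exp (2 - (sqrt (real m + z) + sqrt (real m) / 2) - \<gamma> * (real m + z)) \<le>
        exp (3 + \<gamma> + - sqrt (real m) / 2 + (- sqrt t - \<gamma> * t))"
      unfolding exp_le_cancel_iff by (simp add: algebra_simps)
    also have "\<dots> \<le> exp (3 + \<gamma>) * exp (- sqrt (real m) / 2) * tail F t"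
      using tail_sqrt_bounds(1)[of t] False by (simp only: exp_add) (intro mult_left_mono, auto)
    finally show ?thesis .
  qed
  finally show ?thesis .
qed

text \<open>The region where both coordinates exceed \<open>L\<close> is covered by rectangles
  indexed by the integer part of the smaller one; their probabilities are dominated by the remainder
  of a convergent series times \<open>tail F t\<close>.\<close>

lemma in_class_J: "F \<in> class_J"
proof -
  define a where "a m = exp (- sqrt (real m) / 2)" for m
  have "summable (\<lambda>n. norm (1 / real n ^ 2))"
    using inverse_power_summable[of 2, where 'a=real] by (simp add: field_simps)
  moreover have "a \<in> O(\<lambda>n. 1 / real n ^ 2)"
    unfolding a_def by real_asymp
  ultimately have summable: "summable a"
    by (rule summable_comparison_test_bigo)
  have summable_shift: "summable (\<lambda>k. a (k + L))" for L
    using summable by (rule summable_ignore_initial_segment)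
  define e where "e L = exp (3 + \<gamma>) * (\<Sum>k. a (k + L))" for L
  have "e \<longlonglongrightarrow> exp (3 + \<gamma>) * 0"
    unfolding e_def using summable by (intro tendsto_intros suminf_exist_split2)
  then show ?thesis
  proof (intro class_J_criterion)
    fix L :: nat and t :: real
    \<comment> \<open>If \<open>m < snd p \<le> m + 1\<close>, then \<open>fst p\<close> exceeds
      \<open>m\<close>, being at least \<open>snd p\<close>, and exceeds \<open>t - m - 1\<close>
      because of the sum.\<close>
    define z where "z m = max (real m) (t - real m - 1)" for m
    define R where "R m = {p. fst p \<in> {z m<..} \<and> snd p \<in> {real m<..}}" for m
    have R_prob: "pair.P.prob (R m) = tail F (z m) * tail F (real m)" for m
      unfolding R_def by (subst pair_rectangle) (auto simp: tail_eq_prob)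
    have R_le: "pair.P.prob (R m) \<le> exp (3 + \<gamma>) * a m * tail F t" for m
      using tail_product_le[of m t] by (simp add: R_prob a_def z_def mult.commute)
    have summable_bound: "summable (\<lambda>k. exp (3 + \<gamma>) * a (k + L) * tail F t)"
      using summable_shift by (intro summable_mult summable_mult2)
    have summable_R: "summable (\<lambda>k. pair.P.prob (R (k + L)))"
      by (rule summable_comparison_test'[OF summable_bound, of 0]) (simp add: R_le)
    have R_sets: "R m \<in> pair.P.events" for m
      unfolding R_def by (intro pair_sets) measurable
    have "pair.P.prob {p. real L < snd p \<and> snd p \<le> fst p \<and> t < fst p + snd p} \<le>
        pair.P.prob (\<Union>k. R (k + L))"
    proof (rule pair.P.finite_measure_mono)
      show "{p. real L < snd p \<and> snd p \<le> fst p \<and> t < fst p + snd p} \<subseteq> (\<Union>k. R (k + L))"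
      proof (safe, goal_cases)
        case (1 y x)
        define m where "m = nat (\<lceil>x\<rceil> - 1)"
        have "real m < x" "x \<le> real m + 1" "L \<le> m"
          using 1 unfolding m_def by (simp_all, linarith+)
        then have "(y, x) \<in> R ((m - L) + L)"
          using 1 by (auto simp: R_def z_def)
        then show ?case
          by blast
      qed
      show "(\<Union>k. R (k + L)) \<in> pair.P.events"
        using R_sets by blast
    qed
    also have "\<dots> \<le> (\<Sum>k. pair.P.prob (R (k + L)))"
      using R_sets summable_R by (intro pair.P.finite_measure_subadditive_countably) auto
    also have "\<dots> \<le> (\<Sum>k. exp (3 + \<gamma>) * a (k + L) * tail F t)"
      using summable_R summable_bound by (intro suminf_le R_le)
    also have "\<dots> = e L * tail F t"
      using summable_shift by (simp add: e_def suminf_mult suminf_mult2[symmetric] summable_mult)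
    also have "\<dots> \<le> e L * tail (convolution F F) t"
    proof (rule mult_left_mono[OF tail_le_tail_convolution])
      show "0 \<le> e L"
        unfolding e_def
        by (intro mult_nonneg_nonneg suminf_nonneg summable_shift) (simp_all add: a_def)
    qed
    finally show "pair.P.prob {p. real L < snd p \<and> snd p \<le> fst p \<and> t < fst p + snd p} \<le>
        e L * pair.P.prob {p. t < fst p + snd p}"
      by (simp add: tail_convolution)
  qed simp
qed

end

section \<open>Class memberships of the untempered law\<close>

locale sqrt_tail_0 = sqrt_tail F 0 for F
begin

lemma integrable_id: "integrable F (\<lambda>y. y)"
proof (rule integrableI_bounded)
  have "summable (\<lambda>n. (real n + 1) * tail F (real n))"
  proof (rule summable_comparison_test'[where N=0])
    have "summable (\<lambda>n. norm (1 / real n ^ 2))"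
      using inverse_power_summable[of 2, where 'a=real] by (simp add: field_simps)
    moreover have "(\<lambda>n. (real n + 1) * exp (1 - sqrt (real n))) \<in> O(\<lambda>n. 1 / real n ^ 2)"
      by real_asymp
    ultimately show "summable (\<lambda>n. (real n + 1) * exp (1 - sqrt (real n)))"
      by (rule summable_comparison_test_bigo)
    show "norm ((real n + 1) * tail F (real n)) \<le> (real n + 1) * exp (1 - sqrt (real n))" for n
      using tail_sqrt_bounds(2)[of "real n"] tail_pos[of "real n"] by (simp add: abs_mult)
  qed
  then have "(\<integral>\<^sup>+y\<in>{0..}. ennreal y \<partial>F) < \<infinity>"
    by (intro nn_integral_le_tail_sum[where a="\<lambda>n. real n + 1"]) auto
  moreover have "(\<integral>\<^sup>+y. ennreal (norm y) \<partial>F) = (\<integral>\<^sup>+y\<in>{0..}. ennreal y \<partial>F)"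
    by (rule nn_integral_cong_AE) (use AE_nonneg in eventually_elim, auto)
  ultimately show "(\<integral>\<^sup>+y. ennreal (norm y) \<partial>F) < \<infinity>"
    by simp
qed simp

text \<open>The moment is at least \<open>exp (r * x) * tail F x\<close> for each
  \<open>x \<ge> 0\<close>, and \<open>r * x - sqrt x\<close> is unbounded.\<close>

lemma in_class_K: "F \<in> class_K"
  unfolding class_K_def
proof (intro CollectI conjI in_distributions allI impI)
  fix r :: real assume r: "r > 0"
  let ?I = "\<integral>\<^sup>+y\<in>{0..}. ennreal (exp (r * y)) \<partial>F"
  have bound: "ennreal (exp (r * x - sqrt x)) \<le> ?I" if "x \<ge> 0" for x
  proof -
    have "exp (r * x - sqrt x) \<le> exp (r * x) * tail F x"
      using tail_sqrt_bounds(1)[OF that] by (simp add: exp_diff exp_minus field_simps)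
    then have "ennreal (exp (r * x - sqrt x)) \<le> ennreal (exp (r * x)) * emeasure F {x<..}"
      by (simp add: emeasure_eq_measure tail_eq_prob ennreal_mult[symmetric] ennreal_leI)
    also have "\<dots> = (\<integral>\<^sup>+y. ennreal (exp (r * x)) * indicator {x<..} y \<partial>F)"
      by (simp add: nn_integral_cmult_indicator)
    also have "\<dots> \<le> ?I"
      using r that by (intro nn_integral_mono) (auto simp: indicator_def intro!: ennreal_leI)
    finally show ?thesis .
  qed
  show "?I = \<infinity>"
  proof (rule ccontr)
    assume "?I \<noteq> \<infinity>"
    then obtain B where B: "?I = ennreal B"
      by (cases ?I) auto
    have "filterlim (\<lambda>x. exp (r * x - sqrt x)) at_top at_top"
      using r by real_asymp
    then have "\<forall>\<^sub>F x in at_top. max B 0 < exp (r * x - sqrt x) \<and> 0 \<le> x"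
      by (intro eventually_conj eventually_ge_at_top) (simp add: filterlim_at_top_dense)
    then obtain x where "max B 0 < exp (r * x - sqrt x)" "0 \<le> x"
      by (auto dest: eventually_happens)
    with bound[of x] B show False
      by (auto simp: ennreal_le_iff2)
  qed
qed

text \<open>
  The law has an atom at each \<open>n\<^sup>2\<close> and all its mass on \<open>(1/2, \<infinity>)\<close>. Hence
  \<open>X\<^sub>1 \<ge> n\<^sup>2\<close> already forces \<open>X\<^sub>1 + X\<^sub>2 > n\<^sup>2\<close>, and the tail of the convolution at
  \<open>n\<^sup>2\<close> is at least \<open>exp 1 > 2\<close> times the tail.
\<close>

lemma not_in_class_S: "F \<notin> class_S"
proof
  assume "F \<in> class_S"
  then have "tail (convolution F F) \<sim>[at_top] (\<lambda>x. 2 * tail F x)"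
    by (simp add: class_S_def)
  then have "((\<lambda>x. tail (convolution F F) x / (2 * tail F x)) \<longlongrightarrow> 1) at_top"
    using tail_pos by (intro asymp_equivD_strong) (auto simp: less_imp_neq[THEN not_sym])
  \<comment> \<open>Twice \<open>6 / 5\<close> lies below \<open>5 / 2\<close>, the quadratic Taylor
    lower bound for \<open>exp 1\<close>.\<close>
  then have "\<forall>\<^sub>F x in at_top. tail (convolution F F) x / (2 * tail F x) < 6 / 5"
    by (rule order_tendstoD(2)) simp
  then have "\<forall>\<^sub>F n in at_top. tail (convolution F F) (real n ^ 2) / (2 * tail F (real n ^ 2)) < 6 / 5"
    by (rule eventually_compose_filterlim) real_asymp
  then have "\<forall>\<^sub>F n in at_top. tail (convolution F F) (real n ^ 2) / (2 * tail F (real n ^ 2)) < 6 / 5 \<and> 1 \<le> n"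
    by (intro eventually_conj eventually_ge_at_top)
  then obtain n :: nat where n: "n \<ge> 1"
    "tail (convolution F F) (real n ^ 2) / (2 * tail F (real n ^ 2)) < 6 / 5"
    by (auto dest: eventually_happens)
  \<comment> \<open>The point \<open>1 / 2\<close> to the left of the jump at
    \<open>real n ^ 2\<close> still lies beyond the previous jump, so the floor there is one lower;
    this yields the factor \<open>exp 1\<close>.\<close>
  have "real n - 1 \<le> sqrt (real n ^ 2 - 1 / 2)"
    using n by (intro real_le_rsqrt) (simp add: power2_eq_square algebra_simps)
  moreover have "sqrt (real n ^ 2 - 1 / 2) < real n"
    using n by (intro real_less_lsqrt) auto
  ultimately have floor: "\<lfloor>sqrt (real n ^ 2 - 1 / 2)\<rfloor> = int n - 1"
    using n by (intro floor_unique) (auto simp: of_nat_diff)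
  have "1 \<le> real n ^ 2"
    using n by simp
  then have left_limit: "tail F (real n ^ 2 - 1 / 2) = exp 1 * tail F (real n ^ 2)"
    using floor tail_sqrt[of "real n ^ 2 - 1 / 2"] tail_sqrt[of "real n ^ 2"]
    by (simp add: exp_add[symmetric])
  have "sqrt (1 / 2) < 1"
    by (simp add: real_sqrt_divide)
  then have "\<lfloor>sqrt (1 / 2)\<rfloor> = 0"
    by (intro floor_unique) auto
  then have "tail F (1 / 2) = 1"
    by (simp add: tail_sqrt)
  then have "exp 1 * tail F (real n ^ 2) \<le> tail (convolution F F) (real n ^ 2)"
    using tail_times_le_tail_convolution[of "real n ^ 2" "1 / 2"] left_limit by simp
  moreover have "tail (convolution F F) (real n ^ 2) < 12 / 5 * tail F (real n ^ 2)"
    using n tail_pos[of "real n ^ 2"] by (simp add: field_simps)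
  ultimately have "exp 1 * tail F (real n ^ 2) < 12 / 5 * tail F (real n ^ 2)"
    by linarith
  then have "exp 1 < (12 / 5 :: real)"
    using tail_pos[of "real n ^ 2"] by (simp only: mult_less_cancel_right_pos)
  moreover have "1 + 1 + 1 ^ 2 / 2 \<le> (exp 1 :: real)"
    by (rule exp_lower_Taylor_quadratic) simp
  ultimately show False
    by simp
qed

text \<open>Taking \<open>t = 1 / 4\<close> halves the square root, so the ratio of tails is at
  least \<open>exp (sqrt x / 2 - 1)\<close>, the 1 being the loss from the floor.\<close>

lemma not_in_class_D: "F \<notin> class_D"
proof
  assume "F \<in> class_D"
  then have "\<forall>t\<in>{0<..<1}. (\<lambda>x. tail F (t * x)) \<in> O[at_top](tail F)"
    by (simp add: class_D_def)
  then have "(\<lambda>x. tail F (1 / 4 * x)) \<in> O[at_top](tail F)"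
    by (rule bspec) simp
  then obtain c where c: "\<forall>\<^sub>F x in at_top. norm (tail F (1 / 4 * x)) \<le> c * norm (tail F x)"
    by (auto elim: landau_o.bigE)
  have "filterlim (\<lambda>x. exp (sqrt x / 2 - 1)) at_top at_top"
    by real_asymp
  then have "\<forall>\<^sub>F x in at_top. c < exp (sqrt x / 2 - 1)"
    by (simp add: filterlim_at_top_dense)
  then have "\<forall>\<^sub>F x in at_top. (norm (tail F (1 / 4 * x)) \<le> c * norm (tail F x) \<and> c < exp (sqrt x / 2 - 1)) \<and> 0 \<le> x"
    using c by (intro eventually_conj eventually_ge_at_top)
  then obtain x where x: "norm (tail F (1 / 4 * x)) \<le> c * norm (tail F x)" "c < exp (sqrt x / 2 - 1)" "0 \<le> x"
    by (auto dest: eventually_happens)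
  have "exp (- sqrt (1 / 4 * x)) \<le> c * tail F x"
    using x tail_sqrt_bounds(1)[of "1 / 4 * x"] tail_pos[of x] tail_pos[of "1 / 4 * x"] by auto
  also have "\<dots> < exp (sqrt x / 2 - 1) * tail F x"
    using x tail_pos by (intro mult_strict_right_mono) auto
  also have "\<dots> \<le> exp (sqrt x / 2 - 1) * exp (1 - sqrt x)"
    using x tail_sqrt_bounds(2)[of x] by (intro mult_left_mono) auto
  also have "\<dots> = exp (- sqrt (1 / 4 * x))"
    by (simp add: exp_add[symmetric] real_sqrt_mult real_sqrt_divide)
  finally show False
    by simp
qed

end

text \<open>
  The square of a standard exponential variable rounded up to an integer has the tail
  \<open>exp (- \<lfloor>sqrt x\<rfloor>)\<close>.
\<close>

lemma sqrt_tail_exists: "\<exists>F. sqrt_tail_0 F"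
proof -
  let ?M = "density lborel (exponential_density 1)"
  \<comment> \<open>Truncation at 0 keeps the rounded value nonnegative for every \<open>u\<close>,
    so that comparing squares is equivalent to comparing roots pointwise.\<close>
  let ?X = "\<lambda>u :: real. (real_of_int \<lceil>max u 0\<rceil>) ^ 2"
  interpret M: prob_space ?M
    by (rule prob_space_exponential_density) simp
  have X[measurable]: "?X \<in> borel_measurable ?M"
    by measurable
  define F where "F = distr ?M borel ?X"
  interpret real_distribution F
    unfolding F_def by (rule M.real_distribution_distr[OF X])
  have exp_dist: "distributed ?M lborel (\<lambda>u. u) (exponential_density 1)"
    by (auto simp: distributed_def distr_id2)
  have tail: "tail F x = exp (- real_of_int \<lfloor>sqrt x\<rfloor>)" if "x \<ge> 0" for x
  proof -
    have iff: "x < ?X u \<longleftrightarrow> real_of_int \<lfloor>sqrt x\<rfloor> < u" for u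
    proof -
      have "x < ?X u \<longleftrightarrow> sqrt x < real_of_int \<lceil>max u 0\<rceil>"
        using that real_less_lsqrt[of "real_of_int \<lceil>max u 0\<rceil>" x] real_sqrt_less_iff[of x "?X u"] by auto
      also have "\<dots> \<longleftrightarrow> \<lfloor>sqrt x\<rfloor> < \<lceil>max u 0\<rceil>"
        by linarith
      also have "\<dots> \<longleftrightarrow> real_of_int \<lfloor>sqrt x\<rfloor> < max u 0"
        by (simp add: less_ceiling_iff)
      also have "\<dots> \<longleftrightarrow> real_of_int \<lfloor>sqrt x\<rfloor> < u"
        using that by (auto simp: less_max_iff_disj)
      finally show ?thesis .
    qed
    have "tail F x = measure F {x<..}"
      using prob_compl[of "{..x}"] by (simp add: tail_def cdf_def Compl_eq_Diff_UNIV[symmetric])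
    also have "\<dots> = M.prob {u \<in> space ?M. real_of_int \<lfloor>sqrt x\<rfloor> < u}"
      unfolding F_def by (subst measure_distr[OF X]) (auto simp: iff vimage_def)
    also have "\<dots> = exp (- real_of_int \<lfloor>sqrt x\<rfloor>)"
      using M.exponential_distributedD_gt[OF exp_dist, of "real_of_int \<lfloor>sqrt x\<rfloor>"] that by simp
    finally show ?thesis .
  qed
  have neg: "measure F {..<0} = 0"
    unfolding F_def by (subst measure_distr[OF X]) (auto simp: vimage_def)
  have "cdf F x < 1" for x
  proof (cases "x < 0")
    case True
    have "cdf F x \<le> measure F {..<0}"
      unfolding cdf_def using True by (intro finite_measure_mono) auto
    then show ?thesis
      using neg by simp
  next
    case False
    then show ?thesis
      using tail[of x] by (simp add: tail_def) (metis diff_gt_0_iff_gt exp_gt_zero)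
  qed
  then have "F \<in> nonneg_unbounded_distributions"
    using neg by (simp add: nonneg_unbounded_distributions_def real_distribution_axioms)
  then have "sqrt_tail_0 F"
    by unfold_locales (auto simp: tail)
  then show ?thesis ..
qed

theorem proposition1p4:
  fixes \<gamma> :: real
  assumes "\<gamma> > 0"
  shows "(\<exists>F \<in> (class_J_finite_mean \<inter> class_K) - (class_S \<union> class_D). exp_tempered \<gamma> F \<in> class_J) \<and>
    (\<forall>F \<in> (class_J_finite_mean \<inter> class_K) - (class_S \<union> class_D). exp_tempered \<gamma> F \<in> class_J \<longrightarrow>
       F \<in> class_OS_star \<and>
       exp_tempered \<gamma> F \<in> (class_J \<inter> class_K_compl) - (\<Union>\<beta>\<in>{0<..}. class_S_exp \<beta>))"
proof (intro conjI ballI impI)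
  obtain F where "sqrt_tail_0 F"
    using sqrt_tail_exists ..
  then interpret sqrt_tail_0 F .
  \<comment> \<open>The factor \<open>exp (- \<gamma> * x)\<close> adds the linear term to the
    exponent, so the same \<open>in_class_J\<close> applies to the tempered law.\<close>
  interpret G: sqrt_tail "exp_tempered \<gamma> F" \<gamma>
    using assms by unfold_locales
      (auto simp: exp_tempered_in_distributions[OF assms in_distributions]
        tail_exp_tempered[OF assms in_distributions] tail_sqrt exp_add[symmetric])
  show "\<exists>F \<in> (class_J_finite_mean \<inter> class_K) - (class_S \<union> class_D). exp_tempered \<gamma> F \<in> class_J"
    using in_class_J integrable_id in_class_K not_in_class_S not_in_class_D G.in_class_J
    by (intro bexI[of _ F]) (auto simp: class_J_finite_mean_def)
next
  fix F assume F: "F \<in> (class_J_finite_mean \<inter> class_K) - (class_S \<union> class_D)"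
    and J: "exp_tempered \<gamma> F \<in> class_J"
  interpret nonneg_unbounded F
    using F by (simp add: nonneg_unbounded_def class_K_def)
  show "F \<in> class_OS_star"
    using F J assms
    by (intro class_OS_star_if_exp_tempered_class_J) (auto simp: class_J_finite_mean_def)
  show "exp_tempered \<gamma> F \<in> (class_J \<inter> class_K_compl) - (\<Union>\<beta>\<in>{0<..}. class_S_exp \<beta>)"
    using F J assms exp_tempered_light_tailed exp_tempered_not_convolution_equivalent
    by (auto simp: class_J_finite_mean_def)
qed

end
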